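(* Let $\langle F,E\rangle$ be a weak-* sequentially complete anti-dual pair and let $A,B\in\mathscr L(E;F)$ be positive operators. The following assertions are equivalent: (i) $A$ and $B$ are mutually singular; (ii) $A:B=0$; (iii) the set $\{(Ax,Bx):x\in E\}$ is dense in $\mathcal H_A\times\mathcal H_B$; (iv) $\xi=0$ is the only vector in $\mathcal H_B$ for which there is a constant $M_\xi\ge0$ such that $|(Bx\,|\,\xi)_B|^2\le M_\xi\langle Ax,x\rangle$ for every $x\in E$; (v) $\mathcal M=\mathcal H_B$; (vi) $\operatorname{ran}J_A\cap\operatorname{ran}J_B=\{0\}$; (vii) for every $x\in E$ there is a sequence $(x_n)_{n\in\mathbb N}$ in $E$ such that $\langle Ax_n,x_n\rangle\to0$ and $\langle B(x-x_n),x-x_n\rangle\to0$.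
   Context: An anti-dual pair $\langle F,E\rangle$ consists of complex vector spaces $E,F$ and a map $\langle\cdot,\cdot\rangle:F\times E\to\mathbb C$, linear in the first and conjugate linear in the second variable, that separates the points of $E$ and of $F$. $\sigma(F,E)$ is the weak topology on $F$ induced by the functionals $\langle\cdot,x\rangle$ ($x\in E$), and $\sigma(E,F)$ is the weak topology on $E$ induced by the functionals $\langle f,\cdot\rangle$ ($f\in F$). The pair is weak-* sequentially complete if every Cauchy sequence of $(F,\sigma(F,E))$ converges. $\mathscr L(E;F)$ is the set of $\sigma(E,F)$-$\sigma(F,E)$ continuous linear operators $E\to F$. A linear operator $A:E\to F$ is positive if $\langle Ax,x\rangle\ge0$ for all $x\in E$ (such operators belong to $\mathscr L(E;F)$ automatically); $A\le B$ means that $B-A$ is positive. $A$ and $B$ are mutually singular if $C\le A$ and $C\le B$ imply $C=0$ for every positive $C\in\mathscr L(E;F)$. The parallel sum $A:B\in\mathscr L(E;F)$ is the unique positive operator with $\langle(A:B)x,x\rangle=\inf\{\langle A(x-y),x-y\rangle+\langle By,y\rangle:y\in E\}$ for all $x\in E$. Auxiliary Hilbert spaces: for a positive $A$, $\mathcal H_A$ is the Hilbert completion of $\operatorname{ran}A$ under the (well-defined) inner product $(Ax\,|\,Ay)_A:=\langle Ax,y\rangle$. $J_A:\mathcal H_A\to F$ is the unique weakly continuous (weak topology of $\mathcal H_A$ to $\sigma(F,E)$) linear extension of the inclusion $\operatorname{ran}A\hookrightarrow F$. $\mathcal H_B$ (with inner product $(\cdot\,|\,\cdot)_B$) and $J_B$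 are defined likewise. $\mathcal M:=\{\xi\in\mathcal H_B:(0,\xi)\in\overline{\{(Ax,Bx):x\in E\}}\}$, the closure being taken in $\mathcal H_A\times\mathcal H_B$. *)

theory Defs
  imports "HOL-Analysis.Analysis"
begin

section \<open>Anti-dual pairs and their operators\<close>

locale anti_dual_pair = E: vector_space scaleE + F: vector_space scaleF
  for scaleE :: "complex \<Rightarrow> 'e::ab_group_add \<Rightarrow> 'e"
    and scaleF :: "complex \<Rightarrow> 'f::ab_group_add \<Rightarrow> 'f" +
  fixes pair :: "'f \<Rightarrow> 'e \<Rightarrow> complex"
  assumes pair_add_left: "pair (f + g) x = pair f x + pair g x"
    and pair_scale_left: "pair (scaleF c f) x = c * pair f x"
    and pair_add_right: "pair f (x + y) = pair f x + pair f y"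
    and pair_scale_right: "pair f (scaleE c x) = cnj c * pair f x"
    and pair_separates_F: "f \<noteq> g \<Longrightarrow> \<exists>x. pair f x \<noteq> pair g x"
    and pair_separates_E: "x \<noteq> y \<Longrightarrow> \<exists>f. pair f x \<noteq> pair f y"

definition weak_topology :: "'a set \<Rightarrow> ('a \<Rightarrow> complex) set \<Rightarrow> 'a topology" where
  "weak_topology S \<Phi> = topology_generated_by {{x \<in> S. \<phi> x \<in> U} |\<phi> U. \<phi> \<in> \<Phi> \<and> open U}"

definition sigma_FE :: "('f \<Rightarrow> 'e \<Rightarrow> complex) \<Rightarrow> 'f topology" where
  "sigma_FE pair = weak_topology UNIV {\<lambda>f. pair f x |x. True}"

definition sigma_EF :: "('f \<Rightarrow> 'e \<Rightarrow> complex) \<Rightarrow> 'e topology" where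
  "sigma_EF pair = weak_topology UNIV {\<lambda>x. pair f x |f. True}"

text \<open>Cauchy sequences are taken with respect to the uniformity of the topological vector space.\<close>

definition weak_star_Cauchy :: "('f::ab_group_add \<Rightarrow> 'e \<Rightarrow> complex) \<Rightarrow> (nat \<Rightarrow> 'f) \<Rightarrow> bool" where
  "weak_star_Cauchy pair u \<longleftrightarrow>
     (\<forall>U. openin (sigma_FE pair) U \<and> 0 \<in> U \<longrightarrow> (\<exists>N. \<forall>m\<ge>N. \<forall>n\<ge>N. u m - u n \<in> U))"

definition weak_star_sequentially_complete :: "('f::ab_group_add \<Rightarrow> 'e \<Rightarrow> complex) \<Rightarrow> bool" where
  "weak_star_sequentially_complete pair \<longleftrightarrow>
     (\<forall>u. weak_star_Cauchy pair u \<longrightarrow> (\<exists>f. limitin (sigma_FE pair) u f sequentially))"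

definition weakly_continuous_operators ::
  "(complex \<Rightarrow> 'e::ab_group_add \<Rightarrow> 'e) \<Rightarrow> (complex \<Rightarrow> 'f::ab_group_add \<Rightarrow> 'f) \<Rightarrow>
   ('f \<Rightarrow> 'e \<Rightarrow> complex) \<Rightarrow> ('e \<Rightarrow> 'f) set" where
  "weakly_continuous_operators scaleE scaleF pair =
     {A. Vector_Spaces.linear scaleE scaleF A \<and> continuous_map (sigma_EF pair) (sigma_FE pair) A}"

definition positive_operator ::
  "(complex \<Rightarrow> 'e::ab_group_add \<Rightarrow> 'e) \<Rightarrow> (complex \<Rightarrow> 'f::ab_group_add \<Rightarrow> 'f) \<Rightarrow>
   ('f \<Rightarrow> 'e \<Rightarrow> complex) \<Rightarrow> ('e \<Rightarrow> 'f) \<Rightarrow> bool" where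
  "positive_operator scaleE scaleF pair A \<longleftrightarrow>
     Vector_Spaces.linear scaleE scaleF A \<and> (\<forall>x. pair (A x) x \<in> \<real>\<^sub>\<ge>\<^sub>0)"

definition operator_le ::
  "(complex \<Rightarrow> 'e::ab_group_add \<Rightarrow> 'e) \<Rightarrow> (complex \<Rightarrow> 'f::ab_group_add \<Rightarrow> 'f) \<Rightarrow>
   ('f \<Rightarrow> 'e \<Rightarrow> complex) \<Rightarrow> ('e \<Rightarrow> 'f) \<Rightarrow> ('e \<Rightarrow> 'f) \<Rightarrow> bool" where
  "operator_le scaleE scaleF pair A B \<longleftrightarrow> positive_operator scaleE scaleF pair (\<lambda>x. B x - A x)"

definition mutually_singular ::
  "(complex \<Rightarrow> 'e::ab_group_add \<Rightarrow> 'e) \<Rightarrow> (complex \<Rightarrow> 'f::ab_group_add \<Rightarrow> 'f) \<Rightarrow>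
   ('f \<Rightarrow> 'e \<Rightarrow> complex) \<Rightarrow> ('e \<Rightarrow> 'f) \<Rightarrow> ('e \<Rightarrow> 'f) \<Rightarrow> bool" where
  "mutually_singular scaleE scaleF pair A B \<longleftrightarrow>
     (\<forall>C \<in> weakly_continuous_operators scaleE scaleF pair.
        positive_operator scaleE scaleF pair C \<and>
        operator_le scaleE scaleF pair C A \<and> operator_le scaleE scaleF pair C B \<longrightarrow>
        C = (\<lambda>x. 0))"

definition parallel_sum ::
  "(complex \<Rightarrow> 'e::ab_group_add \<Rightarrow> 'e) \<Rightarrow> (complex \<Rightarrow> 'f::ab_group_add \<Rightarrow> 'f) \<Rightarrow>
   ('f \<Rightarrow> 'e \<Rightarrow> complex) \<Rightarrow> ('e \<Rightarrow> 'f) \<Rightarrow> ('e \<Rightarrow> 'f) \<Rightarrow> 'e \<Rightarrow> 'f" where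
  "parallel_sum scaleE scaleF pair A B =
     (THE C. C \<in> weakly_continuous_operators scaleE scaleF pair \<and>
        positive_operator scaleE scaleF pair C \<and>
        (\<forall>x. pair (C x) x =
           of_real (INF y. Re (pair (A (x - y)) (x - y) + pair (B y) y))))"

section \<open>Complex inner product spaces and their Hilbert completions\<close>

text \<open>
  The spaces below depend on an operator, so they are given by an explicit carrier set with
  explicit operations.  The inner product is linear in its first argument.
\<close>

record 'h ip_space =
  ip_carrier :: "'h set"
  ip_add :: "'h \<Rightarrow> 'h \<Rightarrow> 'h"
  ip_zero :: 'h
  ip_scale :: "complex \<Rightarrow> 'h \<Rightarrow> 'h"
  ip_inner :: "'h \<Rightarrow> 'h \<Rightarrow> complex"

definition ip_diff :: "'h ip_space \<Rightarrow> 'h \<Rightarrow> 'h \<Rightarrow> 'h" where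
  "ip_diff H x y = ip_add H x (ip_scale H (- 1) y)"

definition ip_norm :: "'h ip_space \<Rightarrow> 'h \<Rightarrow> real" where
  "ip_norm H x = sqrt (Re (ip_inner H x x))"

text \<open>
  The locale \<open>Metric_space\<close> requires symmetry and nonnegativity also off the carrier;
  the default value \<open>0\<close> there ensures this.
\<close>

definition ip_dist :: "'h ip_space \<Rightarrow> 'h \<Rightarrow> 'h \<Rightarrow> real" where
  "ip_dist H x y =
     (if x \<in> ip_carrier H \<and> y \<in> ip_carrier H then ip_norm H (ip_diff H x y) else 0)"

definition ip_topology :: "'h ip_space \<Rightarrow> 'h topology" where
  "ip_topology H = Metric_space.mtopology (ip_carrier H) (ip_dist H)"

definition ip_weak_topology :: "'h ip_space \<Rightarrow> 'h topology" where
  "ip_weak_topology H = weak_topology (ip_carrier H) {\<lambda>\<xi>. ip_inner H \<xi> \<eta> |\<eta>. \<eta> \<in> ip_carrier H}"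

text \<open>
  The completion consists of the classes of Cauchy sequences modulo null sequences,
  and a vector is embedded as the class of the constant sequence.
\<close>

definition null_rel :: "'h ip_space \<Rightarrow> ((nat \<Rightarrow> 'h) \<times> (nat \<Rightarrow> 'h)) set" where
  "null_rel H =
     {(u, v). Metric_space.MCauchy (ip_carrier H) (ip_dist H) u \<and>
              Metric_space.MCauchy (ip_carrier H) (ip_dist H) v \<and>
              (\<lambda>n. ip_dist H (u n) (v n)) \<longlonglongrightarrow> 0}"

definition completion_embed :: "'h ip_space \<Rightarrow> 'h \<Rightarrow> (nat \<Rightarrow> 'h) set" where
  "completion_embed H x = null_rel H `` {\<lambda>n. x}"

definition completion :: "'h ip_space \<Rightarrow> (nat \<Rightarrow> 'h) set ip_space" where
  "completion H =
     \<lparr>ip_carrier = {u. Metric_space.MCauchy (ip_carrier H) (ip_dist H) u} // null_rel H,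
      ip_add = (\<lambda>X Y. \<Union>u\<in>X. \<Union>v\<in>Y. null_rel H `` {\<lambda>n. ip_add H (u n) (v n)}),
      ip_zero = completion_embed H (ip_zero H),
      ip_scale = (\<lambda>c X. \<Union>u\<in>X. null_rel H `` {\<lambda>n. ip_scale H c (u n)}),
      ip_inner = (\<lambda>X Y. THE c. \<forall>u\<in>X. \<forall>v\<in>Y. (\<lambda>n. ip_inner H (u n) (v n)) \<longlonglongrightarrow> c)\<rparr>"

section \<open>The auxiliary Hilbert spaces\<close>

text \<open>
  The inner product \<open>(A x | A y)\<^sub>A = \<langle>A x, y\<rangle>\<close> does not depend on the chosen preimage
  \<open>y\<close> when \<open>A\<close> is positive (see \<open>range_space_inner\<close> below).
\<close>

definition range_space ::
  "(complex \<Rightarrow> 'f::ab_group_add \<Rightarrow> 'f) \<Rightarrow> ('f \<Rightarrow> 'e \<Rightarrow> complex) \<Rightarrow> ('e \<Rightarrow> 'f) \<Rightarrow> 'f ip_space" where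
  "range_space scaleF pair A =
     \<lparr>ip_carrier = range A, ip_add = (+), ip_zero = 0, ip_scale = scaleF,
      ip_inner = (\<lambda>f g. pair f (inv A g))\<rparr>"

definition aux_space ::
  "(complex \<Rightarrow> 'f::ab_group_add \<Rightarrow> 'f) \<Rightarrow> ('f \<Rightarrow> 'e \<Rightarrow> complex) \<Rightarrow> ('e \<Rightarrow> 'f) \<Rightarrow>
   (nat \<Rightarrow> 'f) set ip_space" where
  "aux_space scaleF pair A = completion (range_space scaleF pair A)"

definition aux_embed ::
  "(complex \<Rightarrow> 'f::ab_group_add \<Rightarrow> 'f) \<Rightarrow> ('f \<Rightarrow> 'e \<Rightarrow> complex) \<Rightarrow> ('e \<Rightarrow> 'f) \<Rightarrow>
   'f \<Rightarrow> (nat \<Rightarrow> 'f) set" where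
  "aux_embed scaleF pair A = completion_embed (range_space scaleF pair A)"

text \<open>The values of \<open>J\<^sub>A\<close> outside the carrier are fixed by extensionality, so that it is unique.\<close>

definition aux_J ::
  "(complex \<Rightarrow> 'f::ab_group_add \<Rightarrow> 'f) \<Rightarrow> ('f \<Rightarrow> 'e \<Rightarrow> complex) \<Rightarrow> ('e \<Rightarrow> 'f) \<Rightarrow>
   (nat \<Rightarrow> 'f) set \<Rightarrow> 'f" where
  "aux_J scaleF pair A =
     (THE J. J \<in> extensional (ip_carrier (aux_space scaleF pair A)) \<and>
        (\<forall>\<xi> \<in> ip_carrier (aux_space scaleF pair A). \<forall>\<eta> \<in> ip_carrier (aux_space scaleF pair A).
           J (ip_add (aux_space scaleF pair A) \<xi> \<eta>) = J \<xi> + J \<eta>) \<and>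
        (\<forall>c. \<forall>\<xi> \<in> ip_carrier (aux_space scaleF pair A).
           J (ip_scale (aux_space scaleF pair A) c \<xi>) = scaleF c (J \<xi>)) \<and>
        continuous_map (ip_weak_topology (aux_space scaleF pair A)) (sigma_FE pair) J \<and>
        (\<forall>f \<in> range A. J (aux_embed scaleF pair A f) = f))"

definition joint_range ::
  "(complex \<Rightarrow> 'f::ab_group_add \<Rightarrow> 'f) \<Rightarrow> ('f \<Rightarrow> 'e \<Rightarrow> complex) \<Rightarrow> ('e \<Rightarrow> 'f) \<Rightarrow> ('e \<Rightarrow> 'f) \<Rightarrow>
   ((nat \<Rightarrow> 'f) set \<times> (nat \<Rightarrow> 'f) set) set" where
  "joint_range scaleF pair A B =
     {(aux_embed scaleF pair A (A x), aux_embed scaleF pair B (B x)) |x. True}"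

definition joint_topology ::
  "(complex \<Rightarrow> 'f::ab_group_add \<Rightarrow> 'f) \<Rightarrow> ('f \<Rightarrow> 'e \<Rightarrow> complex) \<Rightarrow> ('e \<Rightarrow> 'f) \<Rightarrow> ('e \<Rightarrow> 'f) \<Rightarrow>
   ((nat \<Rightarrow> 'f) set \<times> (nat \<Rightarrow> 'f) set) topology" where
  "joint_topology scaleF pair A B =
     prod_topology (ip_topology (aux_space scaleF pair A)) (ip_topology (aux_space scaleF pair B))"

definition multivalued_part ::
  "(complex \<Rightarrow> 'f::ab_group_add \<Rightarrow> 'f) \<Rightarrow> ('f \<Rightarrow> 'e \<Rightarrow> complex) \<Rightarrow> ('e \<Rightarrow> 'f) \<Rightarrow> ('e \<Rightarrow> 'f) \<Rightarrow>
   (nat \<Rightarrow> 'f) set set" where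
  "multivalued_part scaleF pair A B =
     {\<xi> \<in> ip_carrier (aux_space scaleF pair B).
        (ip_zero (aux_space scaleF pair A), \<xi>)
          \<in> joint_topology scaleF pair A B closure_of joint_range scaleF pair A B}"

section \<open>The completion is a Hilbert space\<close>

locale complex_ip_space =
  fixes H :: "'h ip_space"
  assumes add_closed: "\<lbrakk>x \<in> ip_carrier H; y \<in> ip_carrier H\<rbrakk> \<Longrightarrow> ip_add H x y \<in> ip_carrier H"
    and zero_closed: "ip_zero H \<in> ip_carrier H"
    and scale_closed: "x \<in> ip_carrier H \<Longrightarrow> ip_scale H c x \<in> ip_carrier H"
    and add_assoc: "\<lbrakk>x \<in> ip_carrier H; y \<in> ip_carrier H; z \<in> ip_carrier H\<rbrakk>
      \<Longrightarrow> ip_add H (ip_add H x y) z = ip_add H x (ip_add H y z)"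
    and add_commute: "\<lbrakk>x \<in> ip_carrier H; y \<in> ip_carrier H\<rbrakk> \<Longrightarrow> ip_add H x y = ip_add H y x"
    and add_zero: "x \<in> ip_carrier H \<Longrightarrow> ip_add H (ip_zero H) x = x"
    and add_neg: "x \<in> ip_carrier H \<Longrightarrow> ip_add H x (ip_scale H (- 1) x) = ip_zero H"
    and scale_add_right: "\<lbrakk>x \<in> ip_carrier H; y \<in> ip_carrier H\<rbrakk>
      \<Longrightarrow> ip_scale H c (ip_add H x y) = ip_add H (ip_scale H c x) (ip_scale H c y)"
    and scale_add_left: "x \<in> ip_carrier H
      \<Longrightarrow> ip_scale H (c + d) x = ip_add H (ip_scale H c x) (ip_scale H d x)"
    and scale_scale: "x \<in> ip_carrier H \<Longrightarrow> ip_scale H c (ip_scale H d x) = ip_scale H (c * d) x"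
    and scale_one: "x \<in> ip_carrier H \<Longrightarrow> ip_scale H 1 x = x"
    and inner_add_left: "\<lbrakk>x \<in> ip_carrier H; y \<in> ip_carrier H; z \<in> ip_carrier H\<rbrakk>
      \<Longrightarrow> ip_inner H (ip_add H x y) z = ip_inner H x z + ip_inner H y z"
    and inner_scale_left: "\<lbrakk>x \<in> ip_carrier H; y \<in> ip_carrier H\<rbrakk>
      \<Longrightarrow> ip_inner H (ip_scale H c x) y = c * ip_inner H x y"
    and inner_commute: "\<lbrakk>x \<in> ip_carrier H; y \<in> ip_carrier H\<rbrakk>
      \<Longrightarrow> ip_inner H y x = cnj (ip_inner H x y)"
    and inner_nonneg: "x \<in> ip_carrier H \<Longrightarrow> ip_inner H x x \<in> \<real>\<^sub>\<ge>\<^sub>0"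
    and inner_definite: "\<lbrakk>x \<in> ip_carrier H; ip_inner H x x = 0\<rbrakk> \<Longrightarrow> x = ip_zero H"

locale complex_hilbert_space = complex_ip_space H for H :: "'h ip_space" +
  assumes complete: "Metric_space.mcomplete (ip_carrier H) (ip_dist H)"

context complex_ip_space
begin

abbreviation "S \<equiv> ip_carrier H"
abbreviation "ip \<equiv> ip_inner H"
abbreviation "nrm \<equiv> ip_norm H"
abbreviation "df \<equiv> ip_diff H"
abbreviation "Cau \<equiv> Metric_space.MCauchy S (ip_dist H)"
abbreviation "cls u \<equiv> null_rel H `` {u}"

lemma inner_add_right: "\<lbrakk>x \<in> S; y \<in> S; z \<in> S\<rbrakk> \<Longrightarrow> ip z (ip_add H x y) = ip z x + ip z y"
  by (metis add_closed complex_cnj_add inner_add_left inner_commute)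

lemma inner_scale_right: "\<lbrakk>x \<in> S; y \<in> S\<rbrakk> \<Longrightarrow> ip y (ip_scale H c x) = cnj c * ip y x"
  by (metis complex_cnj_mult inner_commute inner_scale_left scale_closed)

lemma diff_closed: "\<lbrakk>x \<in> S; y \<in> S\<rbrakk> \<Longrightarrow> df x y \<in> S"
  by (simp add: ip_diff_def add_closed scale_closed)

lemma inner_diff_left: "\<lbrakk>x \<in> S; y \<in> S; z \<in> S\<rbrakk> \<Longrightarrow> ip (df x y) z = ip x z - ip y z"
  by (simp add: ip_diff_def inner_add_left inner_scale_left scale_closed)

lemma inner_diff_right: "\<lbrakk>x \<in> S; y \<in> S; z \<in> S\<rbrakk> \<Longrightarrow> ip z (df x y) = ip z x - ip z y"
  by (simp add: ip_diff_def inner_add_right inner_scale_right scale_closed)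

lemma inner_self: "x \<in> S \<Longrightarrow> ip x x = of_real ((nrm x)\<^sup>2)"
  using inner_nonneg[of x]
  by (auto simp: ip_norm_def nonneg_Reals_def simp flip: of_real_power)

lemma norm_nonneg: "x \<in> S \<Longrightarrow> 0 \<le> nrm x"
  using inner_nonneg[of x] by (auto simp: ip_norm_def nonneg_Reals_def)

lemma norm_eqI: "\<lbrakk>x \<in> S; ip x x = of_real (r\<^sup>2); 0 \<le> r\<rbrakk> \<Longrightarrow> nrm x = r"
  by (simp add: ip_norm_def)

lemma Cauchy_Schwarz:
  assumes "x \<in> S" "y \<in> S"
  shows "cmod (ip x y) \<le> nrm x * nrm y"
proof (cases "nrm y = 0")
  case True
  then have "y = ip_zero H"
    using assms inner_definite inner_self by fastforce
  then have "ip y x = ip y x + ip y x"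
    using assms add_zero inner_add_left zero_closed by metis
  then have "ip x y = 0"
    using assms inner_commute[of y x] by simp
  with True show ?thesis by simp
next
  case False
  define c where "c = ip x y / of_real ((nrm y)\<^sup>2)"
  have cs: "ip_scale H c y \<in> S" using assms scale_closed by simp
  have n: "nrm y > 0" using False norm_nonneg assms by fastforce
  have "ip (df x (ip_scale H c y)) (df x (ip_scale H c y))
      = ip x x - cnj c * ip x y - c * ip y x + c * cnj c * ip y y"
    using assms cs by (simp add: inner_diff_left inner_diff_right diff_closed
        inner_scale_left inner_scale_right algebra_simps)
  also have "\<dots> = of_real ((nrm x)\<^sup>2 - (cmod (ip x y))\<^sup>2 / (nrm y)\<^sup>2)"
  proof -
    have 1: "ip y x = cnj (ip x y)" using assms inner_commute by blast
    have 2: "ip x y * cnj (ip x y) = of_real ((cmod (ip x y))\<^sup>2)"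
      by (simp only: complex_norm_square)
    have 3: "cnj c * ip x y = of_real ((cmod (ip x y))\<^sup>2 / (nrm y)\<^sup>2)"
      unfolding c_def using 2 by (simp add: mult.commute)
    have 4: "c * cnj c * ip y y = of_real ((cmod (ip x y))\<^sup>2 / (nrm y)\<^sup>2)"
      using n 2 assms(2) unfolding c_def inner_self[OF assms(2)]
      by (simp add: field_simps power2_eq_square)
    have 5: "c * ip y x = of_real ((cmod (ip x y))\<^sup>2 / (nrm y)\<^sup>2)"
      unfolding c_def 1 using 2 by simp
    show ?thesis unfolding 3 4 5 inner_self[OF assms(1)] by simp
  qed
  finally have "(nrm x)\<^sup>2 - (cmod (ip x y))\<^sup>2 / (nrm y)\<^sup>2 \<ge> 0"
    using inner_nonneg[OF diff_closed[OF assms(1) cs]] by (metis nonneg_Reals_of_real_iff)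
  then have "(cmod (ip x y))\<^sup>2 \<le> (nrm x * nrm y)\<^sup>2"
    using n by (simp add: field_simps power_mult_distrib)
  then show ?thesis
    using norm_nonneg assms by (meson mult_nonneg_nonneg power2_le_imp_le)
qed

lemma norm_add:
  assumes "x \<in> S" "y \<in> S"
  shows "nrm (ip_add H x y) \<le> nrm x + nrm y"
proof -
  have "of_real ((nrm (ip_add H x y))\<^sup>2) = ip x x + ip y y + (ip x y + cnj (ip x y))"
    unfolding inner_self[OF add_closed[OF assms], symmetric] inner_commute[OF assms, symmetric]
    using assms by (simp add: inner_add_left inner_add_right add_closed)
  also have "\<dots> = of_real ((nrm x)\<^sup>2 + (nrm y)\<^sup>2 + 2 * Re (ip x y))"
    using assms by (simp add: inner_self complex_add_cnj)
  finally have "(nrm (ip_add H x y))\<^sup>2 = (nrm x)\<^sup>2 + (nrm y)\<^sup>2 + 2 * Re (ip x y)"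
    using of_real_eq_iff by blast
  also have "\<dots> \<le> (nrm x + nrm y)\<^sup>2"
    using Cauchy_Schwarz[OF assms] complex_Re_le_cmod[of "ip x y"] by (simp add: power2_sum)
  finally show ?thesis
    using assms norm_nonneg by (meson add_nonneg_nonneg power2_le_imp_le)
qed

lemma norm_scale:
  assumes "x \<in> S"
  shows "nrm (ip_scale H c x) = cmod c * nrm x"
proof (rule norm_eqI)
  have "ip (ip_scale H c x) (ip_scale H c x) = (c * cnj c) * of_real ((nrm x)\<^sup>2)"
    using assms inner_self[OF assms] by (simp add: scale_closed inner_scale_left inner_scale_right)
  then show "ip (ip_scale H c x) (ip_scale H c x) = of_real ((cmod c * nrm x)\<^sup>2)"
    unfolding complex_norm_square[symmetric] by (simp add: power_mult_distrib)
qed (simp_all add: assms scale_closed norm_nonneg)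

text \<open>Vectors with the same inner products are equal; this replaces equational reasoning.\<close>

lemma eq_by_inner:
  assumes "x \<in> S" "y \<in> S" "\<And>z. z \<in> S \<Longrightarrow> ip x z = ip y z"
  shows "x = y"
proof -
  have "ip (df x y) (df x y) = 0" using assms by (simp add: inner_diff_left diff_closed)
  then have z: "df x y = ip_zero H" using assms inner_definite diff_closed by blast
  have "x = ip_add H x (ip_zero H)" using assms add_zero add_commute zero_closed by metis
  also have "\<dots> = ip_add H x (ip_add H (ip_scale H (- 1) y) y)"
    using add_neg[OF assms(2)] add_commute assms scale_closed by simp
  also have "\<dots> = ip_add H (df x y) y"
    using assms by (simp add: ip_diff_def add_assoc scale_closed)
  also have "\<dots> = y" using z assms add_zero by simp
  finally show ?thesis .
qed

lemma norm_eq_0: "x \<in> S \<Longrightarrow> nrm x = 0 \<longleftrightarrow> x = ip_zero H"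
proof
  assume "x \<in> S" "nrm x = 0"
  then show "x = ip_zero H" using inner_definite inner_self by fastforce
next
  assume "x \<in> S" "x = ip_zero H"
  moreover have "ip (ip_zero H) x = 0" if "x \<in> S" for x
    using inner_add_left[OF zero_closed zero_closed that] add_zero[OF zero_closed] by simp
  ultimately show "nrm x = 0" by (simp add: ip_norm_def)
qed

lemma diff_scale: "\<lbrakk>x \<in> S; y \<in> S\<rbrakk> \<Longrightarrow> df (ip_scale H c x) (ip_scale H c y) = ip_scale H c (df x y)"
  by (rule eq_by_inner)
    (simp_all add: diff_closed scale_closed inner_diff_left inner_scale_left algebra_simps)

lemma diff_add: "\<lbrakk>x \<in> S; y \<in> S; a \<in> S; b \<in> S\<rbrakk>
  \<Longrightarrow> df (ip_add H x y) (ip_add H a b) = ip_add H (df x a) (df y b)"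
  by (rule eq_by_inner) (simp_all add: diff_closed add_closed inner_diff_left inner_add_left)

lemma diff_triangle: "\<lbrakk>x \<in> S; y \<in> S; z \<in> S\<rbrakk> \<Longrightarrow> df x z = ip_add H (df x y) (df y z)"
  by (rule eq_by_inner) (simp_all add: diff_closed add_closed inner_diff_left inner_add_left)

lemma diff_swap: "\<lbrakk>x \<in> S; y \<in> S\<rbrakk> \<Longrightarrow> df x y = ip_scale H (- 1) (df y x)"
  by (rule eq_by_inner) (simp_all add: diff_closed scale_closed inner_diff_left inner_scale_left)

lemma dist_eq: "\<lbrakk>x \<in> S; y \<in> S\<rbrakk> \<Longrightarrow> ip_dist H x y = nrm (df x y)"
  by (simp add: ip_dist_def)

lemma diff_eq_zero: "\<lbrakk>x \<in> S; y \<in> S\<rbrakk> \<Longrightarrow> df x y = ip_zero H \<longleftrightarrow> x = y"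
proof
  assume "x \<in> S" "y \<in> S" "df x y = ip_zero H"
  moreover have "ip (ip_zero H) z = 0" if "z \<in> S" for z
    using inner_add_left[OF zero_closed zero_closed that] add_zero[OF zero_closed] by simp
  ultimately show "x = y"
    by (metis eq_by_inner inner_diff_left right_minus_eq)
next
  assume "x \<in> S" "y \<in> S" "x = y"
  then show "df x y = ip_zero H" by (simp add: ip_diff_def add_neg)
qed

lemma metric_space: "Metric_space S (ip_dist H)"
proof
  show "0 \<le> ip_dist H x y" for x y
    by (simp add: ip_dist_def diff_closed norm_nonneg)
  show "ip_dist H x y = ip_dist H y x" for x y
    using diff_swap[of x y] by (auto simp: ip_dist_def diff_closed norm_scale)
  show "ip_dist H x y = 0 \<longleftrightarrow> x = y" if "x \<in> S" "y \<in> S" for x y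
    using that by (simp add: dist_eq norm_eq_0 diff_closed diff_eq_zero)
  show "ip_dist H x z \<le> ip_dist H x y + ip_dist H y z" if "x \<in> S" "y \<in> S" "z \<in> S" for x y z
    using that diff_triangle[of x y z] norm_add[of "df x y" "df y z"]
    by (simp add: dist_eq diff_closed)
qed

end

sublocale complex_ip_space \<subseteq> M: Metric_space "ip_carrier H" "ip_dist H"
  by (rule metric_space)

context complex_ip_space
begin

lemma CauD: "Cau u \<Longrightarrow> u n \<in> S"
  by (auto simp: M.MCauchy_def)

lemma CauE:
  assumes "Cau u" "e > 0"
  obtains N where "\<And>m n. N \<le> m \<Longrightarrow> N \<le> n \<Longrightarrow> ip_dist H (u m) (u n) < e"
  using assms unfolding M.MCauchy_def by blast

lemma Cau_add:
  assumes "Cau u" "Cau v"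
  shows "Cau (\<lambda>n. ip_add H (u n) (v n))"
  unfolding M.MCauchy_def
proof (intro conjI allI impI)
  show "range (\<lambda>n. ip_add H (u n) (v n)) \<subseteq> S" using assms assms[THEN CauD] add_closed by auto
  fix e :: real assume "e > 0"
  then obtain N1 N2 where N: "\<And>m n. N1 \<le> m \<Longrightarrow> N1 \<le> n \<Longrightarrow> ip_dist H (u m) (u n) < e/2"
      "\<And>m n. N2 \<le> m \<Longrightarrow> N2 \<le> n \<Longrightarrow> ip_dist H (v m) (v n) < e/2"
    using CauE[OF assms(1), of "e/2"] CauE[OF assms(2), of "e/2"] by (metis half_gt_zero)
  have "ip_dist H (ip_add H (u m) (v m)) (ip_add H (u n) (v n)) < e"
    if "max N1 N2 \<le> m" "max N1 N2 \<le> n" for m n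
    using that N[of m n] assms[THEN CauD] norm_add[of "df (u m) (u n)" "df (v m) (v n)"]
    by (simp add: dist_eq add_closed diff_add diff_closed)
  then show "\<exists>N. \<forall>m n. N \<le> m \<longrightarrow> N \<le> n \<longrightarrow>
      ip_dist H (ip_add H (u m) (v m)) (ip_add H (u n) (v n)) < e" by blast
qed

lemma Cau_scale:
  assumes "Cau u"
  shows "Cau (\<lambda>n. ip_scale H c (u n))"
  unfolding M.MCauchy_def
proof (intro conjI allI impI)
  show "range (\<lambda>n. ip_scale H c (u n)) \<subseteq> S" using assms assms[THEN CauD] scale_closed by auto
  fix e :: real assume e: "e > 0"
  then have "e / (cmod c + 1) > 0" by (simp add: add_nonneg_pos)
  then obtain N where N: "\<And>m n. N \<le> m \<Longrightarrow> N \<le> n \<Longrightarrow> ip_dist H (u m) (u n) < e / (cmod c + 1)"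
    using CauE[OF assms] by blast
  have "ip_dist H (ip_scale H c (u m)) (ip_scale H c (u n)) < e" if "N \<le> m" "N \<le> n" for m n
  proof -
    have "ip_dist H (ip_scale H c (u m)) (ip_scale H c (u n)) = cmod c * ip_dist H (u m) (u n)"
      using assms assms[THEN CauD] by (simp add: dist_eq scale_closed diff_scale diff_closed norm_scale)
    also have "\<dots> \<le> (cmod c + 1) * ip_dist H (u m) (u n)" by (simp add: mult_right_mono)
    also have "\<dots> < e" using N[OF that] by (simp add: pos_less_divide_eq add_nonneg_pos mult.commute)
    finally show ?thesis .
  qed
  then show "\<exists>N. \<forall>m n. N \<le> m \<longrightarrow> N \<le> n \<longrightarrow>
      ip_dist H (ip_scale H c (u m)) (ip_scale H c (u n)) < e" by blast
qed

lemma Cau_bounded: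
  assumes "Cau u"
  obtains K where "K > 0" "\<And>n. nrm (u n) \<le> K"
proof -
  have "M.mbounded (range u)" using assms M.MCauchy_imp_mbounded by blast
  then obtain x b where b: "x \<in> S" "\<And>n. ip_dist H x (u n) \<le> b"
    unfolding M.mbounded_def by (metis M.in_mcball range_subsetD)
  have "nrm (u n) \<le> \<bar>b\<bar> + nrm x + 1" for n
  proof -
    have "u n = ip_add H (df (u n) x) x"
      using b CauD[OF assms]
      by (intro eq_by_inner) (simp_all add: inner_add_left inner_diff_left add_closed diff_closed)
    then have "nrm (u n) \<le> nrm (df (u n) x) + nrm x"
      by (metis norm_add b(1) diff_closed CauD[OF assms])
    moreover have "nrm (df (u n) x) \<le> b"
      using b(2)[of n] M.commute[of x "u n"] dist_eq[OF CauD[OF assms] b(1)] by simp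
    ultimately show ?thesis by linarith
  qed
  moreover have "\<bar>b\<bar> + nrm x + 1 > 0" using norm_nonneg[OF b(1)] by linarith
  ultimately show ?thesis using that by blast
qed

lemma inner_diff_bound:
  assumes "x \<in> S" "y \<in> S" "a \<in> S" "b \<in> S"
  shows "cmod (ip x y - ip a b) \<le> ip_dist H x a * nrm y + nrm a * ip_dist H y b"
proof -
  have "ip x y - ip a b = ip (df x a) y + ip a (df y b)"
    using assms by (simp add: inner_diff_left inner_diff_right)
  then have "cmod (ip x y - ip a b) \<le> cmod (ip (df x a) y) + cmod (ip a (df y b))"
    by (simp add: norm_triangle_ineq)
  also have "\<dots> \<le> nrm (df x a) * nrm y + nrm a * nrm (df y b)"
    using assms by (intro add_mono Cauchy_Schwarz) (simp_all add: diff_closed)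
  finally show ?thesis using assms by (simp add: dist_eq)
qed

lemma inner_convergent:
  assumes "Cau u" "Cau v"
  obtains c where "(\<lambda>n. ip (u n) (v n)) \<longlonglongrightarrow> c"
proof -
  obtain K L where K: "K > 0" "\<And>n. nrm (u n) \<le> K" and L: "L > 0" "\<And>n. nrm (v n) \<le> L"
    using Cau_bounded assms by metis
  have "Cauchy (\<lambda>n. ip (u n) (v n))"
    unfolding Cauchy_def
  proof (intro allI impI)
    fix e :: real assume "e > 0"
    then have "e / (2 * K) > 0" "e / (2 * L) > 0" using K L by auto
    then obtain N1 N2 where N: "\<And>m n. N1 \<le> m \<Longrightarrow> N1 \<le> n \<Longrightarrow> ip_dist H (u m) (u n) < e / (2 * L)"
      "\<And>m n. N2 \<le> m \<Longrightarrow> N2 \<le> n \<Longrightarrow> ip_dist H (v m) (v n) < e / (2 * K)"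
      using CauE[OF assms(1), of "e / (2 * L)"] CauE[OF assms(2), of "e / (2 * K)"] by metis
    have "dist (ip (u m) (v m)) (ip (u n) (v n)) < e" if "max N1 N2 \<le> m" "max N1 N2 \<le> n" for m n
    proof -
      have "dist (ip (u m) (v m)) (ip (u n) (v n))
          \<le> ip_dist H (u m) (u n) * nrm (v m) + nrm (u n) * ip_dist H (v m) (v n)"
        unfolding dist_norm using assms assms[THEN CauD] by (intro inner_diff_bound)
      also have "\<dots> \<le> ip_dist H (u m) (u n) * L + K * ip_dist H (v m) (v n)"
        using K L by (intro add_mono mult_left_mono mult_right_mono) auto
      also have "\<dots> < e / (2 * L) * L + K * (e / (2 * K))"
        using K L N that by (intro add_strict_mono mult_strict_left_mono mult_strict_right_mono) auto
      also have "\<dots> = e" using K L by simp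
      finally show ?thesis .
    qed
    then show "\<exists>M. \<forall>m\<ge>M. \<forall>n\<ge>M. dist (ip (u m) (v m)) (ip (u n) (v n)) < e" by blast
  qed
  then show ?thesis using that Cauchy_convergent_iff convergent_def by blast
qed

lemma rel_iff: "(u, v) \<in> null_rel H \<longleftrightarrow> Cau u \<and> Cau v \<and> (\<lambda>n. ip_dist H (u n) (v n)) \<longlonglongrightarrow> 0"
  by (simp add: null_rel_def)

lemma rel_refl: "Cau u \<Longrightarrow> (u, u) \<in> null_rel H"
proof -
  assume u: "Cau u"
  show ?thesis using u CauD[OF u] by (simp add: rel_iff)
qed

lemma null_trans:
  assumes "(u, v) \<in> null_rel H" "(v, w) \<in> null_rel H"
  shows "(u, w) \<in> null_rel H"
proof -
  have C: "Cau u" "Cau v" "Cau w" using assms unfolding rel_iff by blast+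
  have lim: "(\<lambda>n. ip_dist H (u n) (v n) + ip_dist H (v n) (w n)) \<longlonglongrightarrow> 0"
    using assms tendsto_add[of "\<lambda>n. ip_dist H (u n) (v n)" 0 _ "\<lambda>n. ip_dist H (v n) (w n)" 0]
    unfolding rel_iff by simp
  have "\<bar>ip_dist H (u n) (w n)\<bar> \<le> ip_dist H (u n) (v n) + ip_dist H (v n) (w n)" for n
    using M.triangle[OF C(1)[THEN CauD, of n] C(2)[THEN CauD, of n] C(3)[THEN CauD, of n]] by simp
  then have "(\<lambda>n. ip_dist H (u n) (w n)) \<longlonglongrightarrow> 0"
    by (intro Lim_null_comparison[OF always_eventually lim] allI) simp
  then show ?thesis using C unfolding rel_iff by blast
qed

lemma equiv_null: "equiv {u. Cau u} (null_rel H)"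
proof (rule equivI)
  show "null_rel H \<subseteq> {u. Cau u} \<times> {u. Cau u}" unfolding null_rel_def by blast
  show "refl_on {u. Cau u} (null_rel H)"
    unfolding refl_on_def using rel_refl by blast
  show "sym (null_rel H)"
  proof (rule symI)
    fix u v assume "(u, v) \<in> null_rel H"
    then show "(v, u) \<in> null_rel H"
      unfolding rel_iff M.commute[of "v _"] by blast
  qed
  show "trans (null_rel H)"
    by (rule transI) (rule null_trans)
qed

lemma inner_rel:
  assumes "(u, u') \<in> null_rel H" "(v, v') \<in> null_rel H" "(\<lambda>n. ip (u n) (v n)) \<longlonglongrightarrow> c"
  shows "(\<lambda>n. ip (u' n) (v' n)) \<longlonglongrightarrow> c"
proof -
  have C: "Cau u" "Cau u'" "Cau v" "Cau v'" using assms by (auto simp: rel_iff)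
  obtain K L where K: "K > 0" "\<And>n. nrm (u' n) \<le> K" and L: "L > 0" "\<And>n. nrm (v n) \<le> L"
    using Cau_bounded C by metis
  have lim: "(\<lambda>n. ip_dist H (u n) (u' n) * L + K * ip_dist H (v n) (v' n)) \<longlonglongrightarrow> 0 * L + K * 0"
    by (intro tendsto_add tendsto_mult_right tendsto_mult_left)
      (use assms in \<open>simp_all add: rel_iff\<close>)
  then have lim0: "(\<lambda>n. ip_dist H (u n) (u' n) * L + K * ip_dist H (v n) (v' n)) \<longlonglongrightarrow> 0"
    by simp
  have "cmod (ip (u n) (v n) - ip (u' n) (v' n))
      \<le> ip_dist H (u n) (u' n) * L + K * ip_dist H (v n) (v' n)" for n
  proof -
    have "cmod (ip (u n) (v n) - ip (u' n) (v' n))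
        \<le> ip_dist H (u n) (u' n) * nrm (v n) + nrm (u' n) * ip_dist H (v n) (v' n)"
      using C[THEN CauD] by (intro inner_diff_bound)
    also have "\<dots> \<le> ip_dist H (u n) (u' n) * L + K * ip_dist H (v n) (v' n)"
      using K L by (intro add_mono mult_left_mono mult_right_mono) auto
    finally show ?thesis .
  qed
  then have "(\<lambda>n. ip (u n) (v n) - ip (u' n) (v' n)) \<longlonglongrightarrow> 0"
    by (intro Lim_null_comparison[OF always_eventually lim0] allI)
  from tendsto_diff[OF assms(3) this] show ?thesis by simp
qed

abbreviation "Hc \<equiv> completion H"

lemma carrier_completion: "X \<in> ip_carrier Hc \<longleftrightarrow> (\<exists>u. Cau u \<and> X = cls u)"
  by (auto simp: completion_def quotient_def)

lemma cls_eq: "Cau u \<Longrightarrow> Cau v \<Longrightarrow> cls u = cls v \<longleftrightarrow> (\<lambda>n. ip_dist H (u n) (v n)) \<longlonglongrightarrow> 0"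
  using eq_equiv_class_iff[OF equiv_null, of u v] by (simp add: rel_iff)

lemma add_cls:
  assumes "Cau u" "Cau v"
  shows "ip_add Hc (cls u) (cls v) = cls (\<lambda>n. ip_add H (u n) (v n))"
proof -
  have eq: "cls (\<lambda>n. ip_add H (a n) (b n)) = cls (\<lambda>n. ip_add H (u n) (v n))"
    if "a \<in> cls u" "b \<in> cls v" for a b
  proof -
    have C: "Cau a" "Cau b" and ab: "(\<lambda>n. ip_dist H (u n) (a n)) \<longlonglongrightarrow> 0" "(\<lambda>n. ip_dist H (v n) (b n)) \<longlonglongrightarrow> 0"
      using that unfolding Image_singleton_iff rel_iff by blast+
    have lim: "(\<lambda>n. ip_dist H (u n) (a n) + ip_dist H (v n) (b n)) \<longlonglongrightarrow> 0"
      using tendsto_add[OF ab] by simp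
    have "norm (ip_dist H (ip_add H (a n) (b n)) (ip_add H (u n) (v n)))
        \<le> ip_dist H (u n) (a n) + ip_dist H (v n) (b n)" for n
      using assms[THEN CauD] C[THEN CauD] norm_add[of "df (a n) (u n)" "df (b n) (v n)"]
        M.commute[of "u n" "a n"] M.commute[of "v n" "b n"]
      by (simp add: dist_eq add_closed diff_add diff_closed norm_nonneg)
    then have "(\<lambda>n. ip_dist H (ip_add H (a n) (b n)) (ip_add H (u n) (v n))) \<longlonglongrightarrow> 0"
      by (intro Lim_null_comparison[OF always_eventually lim] allI)
    then show ?thesis using cls_eq[OF Cau_add[OF C] Cau_add[OF assms]] by simp
  qed
  have "cls u \<noteq> {}" "cls v \<noteq> {}" using rel_refl assms by blast+
  moreover have "ip_add Hc (cls u) (cls v) = (\<Union>a\<in>cls u. \<Union>b\<in>cls v. cls (\<lambda>n. ip_add H (a n) (b n)))"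
    unfolding completion_def by (simp only: ip_space.simps)
  moreover have "\<dots> = (\<Union>a\<in>cls u. \<Union>b\<in>cls v. cls (\<lambda>n. ip_add H (u n) (v n)))"
    by (intro SUP_cong refl eq)
  ultimately show ?thesis by (simp only: UN_constant if_False)
qed

lemma scale_cls:
  assumes "Cau u"
  shows "ip_scale Hc c (cls u) = cls (\<lambda>n. ip_scale H c (u n))"
proof -
  have eq: "cls (\<lambda>n. ip_scale H c (a n)) = cls (\<lambda>n. ip_scale H c (u n))"
    if "a \<in> cls u" for a
  proof -
    have C: "Cau a" and a: "(\<lambda>n. ip_dist H (u n) (a n)) \<longlonglongrightarrow> 0"
      using that unfolding Image_singleton_iff rel_iff by blast+
    have lim: "(\<lambda>n. cmod c * ip_dist H (u n) (a n)) \<longlonglongrightarrow> 0"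
      using tendsto_mult_left[OF a, of "cmod c"] by simp
    have "norm (ip_dist H (ip_scale H c (a n)) (ip_scale H c (u n)))
        \<le> cmod c * ip_dist H (u n) (a n)" for n
      using CauD[OF assms] CauD[OF C] M.commute[of "u n" "a n"]
      by (simp add: dist_eq scale_closed diff_scale diff_closed norm_scale norm_nonneg)
    then have "(\<lambda>n. ip_dist H (ip_scale H c (a n)) (ip_scale H c (u n))) \<longlonglongrightarrow> 0"
      by (intro Lim_null_comparison[OF always_eventually lim] allI)
    then show ?thesis using cls_eq[OF Cau_scale[OF C] Cau_scale[OF assms]] by simp
  qed
  have "cls u \<noteq> {}" using rel_refl assms by blast
  moreover have "ip_scale Hc c (cls u) = (\<Union>a\<in>cls u. cls (\<lambda>n. ip_scale H c (a n)))"
    unfolding completion_def by (simp only: ip_space.simps)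
  moreover have "\<dots> = (\<Union>a\<in>cls u. cls (\<lambda>n. ip_scale H c (u n)))"
    by (intro SUP_cong refl eq)
  ultimately show ?thesis by (simp only: UN_constant if_False)
qed

lemma inner_cls:
  assumes "Cau u" "Cau v"
  shows "(\<lambda>n. ip (u n) (v n)) \<longlonglongrightarrow> ip_inner Hc (cls u) (cls v)"
proof -
  obtain c where c: "(\<lambda>n. ip (u n) (v n)) \<longlonglongrightarrow> c" using inner_convergent assms by blast
  have r: "u \<in> cls u" "v \<in> cls v" using rel_refl assms by blast+
  have "ip_inner Hc (cls u) (cls v) = c"
    unfolding completion_def ip_space.simps
  proof (rule the_equality)
    show "\<forall>a\<in>cls u. \<forall>b\<in>cls v. (\<lambda>n. ip (a n) (b n)) \<longlonglongrightarrow> c"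
    proof (intro ballI)
      fix a b assume "a \<in> cls u" "b \<in> cls v"
      then show "(\<lambda>n. ip (a n) (b n)) \<longlonglongrightarrow> c"
        unfolding Image_singleton_iff by (rule inner_rel[OF _ _ c])
    qed
  next
    fix d assume "\<forall>a\<in>cls u. \<forall>b\<in>cls v. (\<lambda>n. ip (a n) (b n)) \<longlonglongrightarrow> d"
    then have "(\<lambda>n. ip (u n) (v n)) \<longlonglongrightarrow> d" using r by blast
    then show "d = c" using c LIMSEQ_unique by blast
  qed
  with c show ?thesis by simp
qed

lemma zero_cls: "ip_zero Hc = cls (\<lambda>n. ip_zero H)"
  by (simp add: completion_def completion_embed_def)

lemma diff_zero:
  assumes "x \<in> S"
  shows "df x (ip_zero H) = x"
proof -
  have "df (ip_zero H) (ip_zero H) = ip_zero H" using diff_eq_zero zero_closed by blast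
  then have "ip z (ip_zero H) = 0" if "z \<in> S" for z
    using inner_diff_right[OF zero_closed zero_closed that] by simp
  then have "ip (ip_zero H) z = 0" if "z \<in> S" for z
    using inner_commute[OF that zero_closed] that by simp
  then show ?thesis
    using assms by (intro eq_by_inner) (simp_all add: diff_closed zero_closed inner_diff_left)
qed

lemma cls_eq_zero:
  assumes "Cau u"
  shows "cls u = ip_zero Hc \<longleftrightarrow> (\<lambda>n. nrm (u n)) \<longlonglongrightarrow> 0"
proof -
  have "ip_dist H (u n) (ip_zero H) = nrm (u n)" for n
    using CauD[OF assms, of n] by (simp add: dist_eq zero_closed diff_zero)
  moreover have "Cau (\<lambda>n. ip_zero H)" using zero_closed M.MCauchy_const by blast
  ultimately show ?thesis using cls_eq[OF assms, of "\<lambda>n. ip_zero H"] by (simp add: zero_cls)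
qed

lemma cls_closed: "Cau u \<Longrightarrow> cls u \<in> ip_carrier Hc"
  using carrier_completion by blast

lemma completion_cases:
  assumes "X \<in> ip_carrier Hc"
  obtains u where "Cau u" "X = cls u" "\<And>n. u n \<in> S"
  using assms CauD carrier_completion by metis

lemma ip_space_completion: "complex_ip_space Hc"
proof
  fix X Y assume X: "X \<in> ip_carrier Hc" and Y: "Y \<in> ip_carrier Hc"
  obtain u where u: "Cau u" "X = cls u" "\<And>n. u n \<in> S" using X completion_cases by blast
  obtain v where v: "Cau v" "Y = cls v" "\<And>n. v n \<in> S" using Y completion_cases by blast
  note uv = inner_cls[OF u(1) v(1), folded u(2) v(2)]
  show "ip_add Hc X Y \<in> ip_carrier Hc"
    unfolding u(2) v(2) add_cls[OF u(1) v(1)] by (intro cls_closed Cau_add u v)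
  show "ip_add Hc X Y = ip_add Hc Y X"
    unfolding u(2) v(2) add_cls[OF u(1) v(1)] add_cls[OF v(1) u(1)]
    using add_commute[OF u(3) v(3)] by simp
  show "ip_scale Hc c (ip_add Hc X Y) = ip_add Hc (ip_scale Hc c X) (ip_scale Hc c Y)" for c
    unfolding u(2) v(2) add_cls[OF u(1) v(1)] scale_cls[OF u(1)] scale_cls[OF v(1)]
      scale_cls[OF Cau_add[OF u(1) v(1)]] add_cls[OF Cau_scale[OF u(1)] Cau_scale[OF v(1)]]
    using scale_add_right[OF u(3) v(3)] by simp
  show "ip_inner Hc (ip_scale Hc c X) Y = c * ip_inner Hc X Y" for c
  proof (rule LIMSEQ_unique)
    show "(\<lambda>n. c * ip (u n) (v n)) \<longlonglongrightarrow> ip_inner Hc (ip_scale Hc c X) Y"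
      using inner_cls[OF Cau_scale[OF u(1)] v(1), of c] inner_scale_left[OF u(3) v(3)]
      unfolding u(2) v(2) scale_cls[OF u(1)] by simp
    show "(\<lambda>n. c * ip (u n) (v n)) \<longlonglongrightarrow> c * ip_inner Hc X Y"
      by (rule tendsto_mult_left[OF uv])
  qed
  show "ip_inner Hc Y X = cnj (ip_inner Hc X Y)"
  proof (rule LIMSEQ_unique)
    show "(\<lambda>n. cnj (ip (u n) (v n))) \<longlonglongrightarrow> cnj (ip_inner Hc X Y)"
      by (rule tendsto_cnj[OF uv])
    show "(\<lambda>n. cnj (ip (u n) (v n))) \<longlonglongrightarrow> ip_inner Hc Y X"
      using inner_cls[OF v(1) u(1), folded u(2) v(2)] inner_commute[OF u(3) v(3)] by simp
  qed
  fix Z assume Z: "Z \<in> ip_carrier Hc"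
  obtain w where w: "Cau w" "Z = cls w" "\<And>n. w n \<in> S" using Z completion_cases by blast
  note uw = inner_cls[OF u(1) w(1), folded u(2) w(2)]
  note vw = inner_cls[OF v(1) w(1), folded v(2) w(2)]
  show "ip_add Hc (ip_add Hc X Y) Z = ip_add Hc X (ip_add Hc Y Z)"
    unfolding u(2) v(2) w(2) add_cls[OF u(1) v(1)] add_cls[OF v(1) w(1)]
      add_cls[OF Cau_add[OF u(1) v(1)] w(1)] add_cls[OF u(1) Cau_add[OF v(1) w(1)]]
    using add_assoc[OF u(3) v(3) w(3)] by simp
  show "ip_inner Hc (ip_add Hc X Y) Z = ip_inner Hc X Z + ip_inner Hc Y Z"
  proof (rule LIMSEQ_unique)
    show "(\<lambda>n. ip (u n) (w n) + ip (v n) (w n)) \<longlonglongrightarrow> ip_inner Hc (ip_add Hc X Y) Z"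
      using inner_cls[OF Cau_add[OF u(1) v(1)] w(1)] inner_add_left[OF u(3) v(3) w(3)]
      unfolding u(2) v(2) w(2) add_cls[OF u(1) v(1)] by simp
    show "(\<lambda>n. ip (u n) (w n) + ip (v n) (w n)) \<longlonglongrightarrow> ip_inner Hc X Z + ip_inner Hc Y Z"
      by (rule tendsto_add[OF uw vw])
  qed
next
  have zc: "Cau (\<lambda>n. ip_zero H)" using zero_closed M.MCauchy_const by blast
  show "ip_zero Hc \<in> ip_carrier Hc"
    unfolding zero_cls by (rule cls_closed[OF zc])
  fix X assume X: "X \<in> ip_carrier Hc"
  obtain u where u: "Cau u" "X = cls u" "\<And>n. u n \<in> S" using X completion_cases by blast
  show "ip_scale Hc c X \<in> ip_carrier Hc" for c
    unfolding u(2) scale_cls[OF u(1)] by (intro cls_closed Cau_scale u)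
  show "ip_add Hc (ip_zero Hc) X = X"
    unfolding u(2) zero_cls add_cls[OF zc u(1)] using add_zero[OF u(3)] by simp
  show "ip_add Hc X (ip_scale Hc (- 1) X) = ip_zero Hc"
    unfolding u(2) zero_cls scale_cls[OF u(1)] add_cls[OF u(1) Cau_scale[OF u(1)]]
    using add_neg[OF u(3)] by simp
  show "ip_scale Hc (c + d) X = ip_add Hc (ip_scale Hc c X) (ip_scale Hc d X)" for c d
    unfolding u(2) scale_cls[OF u(1)] add_cls[OF Cau_scale[OF u(1)] Cau_scale[OF u(1)]]
    using scale_add_left[OF u(3)] by simp
  show "ip_scale Hc c (ip_scale Hc d X) = ip_scale Hc (c * d) X" for c d
    unfolding u(2) scale_cls[OF u(1)] scale_cls[OF Cau_scale[OF u(1)]]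
    using scale_scale[OF u(3)] by simp
  show "ip_scale Hc 1 X = X"
    unfolding u(2) scale_cls[OF u(1)] using scale_one[OF u(3)] by simp
  note lim = inner_cls[OF u(1) u(1), folded u(2)]
  show "ip_inner Hc X X \<in> \<real>\<^sub>\<ge>\<^sub>0"
    by (rule closed_sequentially[OF closed_nonneg_Reals_complex _ lim]) (rule inner_nonneg[OF u(3)])
  show "X = ip_zero Hc" if "ip_inner Hc X X = 0"
  proof -
    have "(\<lambda>n. nrm (u n)) \<longlonglongrightarrow> 0"
      unfolding ip_norm_def using tendsto_real_sqrt[OF tendsto_Re[OF lim]] that by simp
    then show ?thesis unfolding u(2) cls_eq_zero[OF u(1)] .
  qed
qed

lemma norm_cls:
  assumes "Cau u"
  shows "(\<lambda>n. nrm (u n)) \<longlonglongrightarrow> ip_norm Hc (cls u)"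
  unfolding ip_norm_def by (intro tendsto_intros inner_cls assms)

lemma dist_cls:
  assumes "Cau u" "Cau v"
  shows "(\<lambda>n. ip_dist H (u n) (v n)) \<longlonglongrightarrow> ip_dist Hc (cls u) (cls v)"
proof -
  have "ip_diff Hc (cls u) (cls v) = cls (\<lambda>n. df (u n) (v n))" "Cau (\<lambda>n. df (u n) (v n))"
    unfolding ip_diff_def using assms by (simp_all add: add_cls scale_cls Cau_add Cau_scale)
  then have "(\<lambda>n. nrm (df (u n) (v n))) \<longlonglongrightarrow> ip_dist Hc (cls u) (cls v)"
    using norm_cls carrier_completion assms by (auto simp: ip_dist_def)
  then show ?thesis using assms assms[THEN CauD] by (simp add: dist_eq)
qed

lemma embed_closed: "x \<in> S \<Longrightarrow> completion_embed H x \<in> ip_carrier Hc"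
  unfolding completion_embed_def using carrier_completion M.MCauchy_const by blast

lemma embed_add: "\<lbrakk>x \<in> S; y \<in> S\<rbrakk> \<Longrightarrow>
    completion_embed H (ip_add H x y) = ip_add Hc (completion_embed H x) (completion_embed H y)"
  by (simp add: completion_embed_def add_cls)

lemma embed_scale: "x \<in> S \<Longrightarrow> completion_embed H (ip_scale H c x) = ip_scale Hc c (completion_embed H x)"
  by (simp add: completion_embed_def scale_cls)

lemma embed_inner: "\<lbrakk>x \<in> S; y \<in> S\<rbrakk> \<Longrightarrow>
    ip_inner Hc (completion_embed H x) (completion_embed H y) = ip x y"
  using inner_cls[of "\<lambda>n. x" "\<lambda>n. y"] LIMSEQ_unique[OF tendsto_const]
  by (fastforce simp: completion_embed_def)

lemma embed_tendsto:
  assumes "Cau u"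
  shows "(\<lambda>k. ip_dist Hc (completion_embed H (u k)) (cls u)) \<longlonglongrightarrow> 0"
proof (rule LIMSEQ_I)
  interpret C: complex_ip_space Hc by (rule ip_space_completion)
  fix r :: real assume "r > 0"
  then obtain N where N: "\<And>m n. N \<le> m \<Longrightarrow> N \<le> n \<Longrightarrow> ip_dist H (u m) (u n) < r / 2"
    using CauE[OF assms, of "r / 2"] by auto
  have "ip_dist Hc (completion_embed H (u k)) (cls u) \<le> r / 2" if "k \<ge> N" for k
  proof (rule LIMSEQ_le_const2)
    show "(\<lambda>n. ip_dist H (u k) (u n)) \<longlonglongrightarrow> ip_dist Hc (completion_embed H (u k)) (cls u)"
      using dist_cls[of "\<lambda>n. u k" u] assms assms[THEN CauD] by (simp add: completion_embed_def)
    show "\<exists>N. \<forall>n\<ge>N. ip_dist H (u k) (u n) \<le> r / 2" using N that less_imp_le by blast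
  qed
  then show "\<exists>no. \<forall>n\<ge>no. norm (ip_dist Hc (completion_embed H (u n)) (cls u) - 0) < r"
    using \<open>r > 0\<close> by (intro exI[of _ N]) fastforce
qed

lemma embed_dist:
  assumes "x \<in> S" "y \<in> S"
  shows "ip_dist Hc (completion_embed H x) (completion_embed H y) = ip_dist H x y"
  using dist_cls[of "\<lambda>n. x" "\<lambda>n. y"] LIMSEQ_unique[OF tendsto_const] assms
  by (fastforce simp: completion_embed_def)

theorem embed_dense: "ip_topology Hc closure_of (completion_embed H ` S) = ip_carrier Hc"
proof -
  interpret C: complex_ip_space Hc by (rule ip_space_completion)
  have "\<exists>y\<in>completion_embed H ` S. y \<in> C.M.mball X r" if X: "X \<in> ip_carrier Hc" and r: "r > 0" for X r
  proof -
    obtain u where u: "Cau u" "X = cls u" using X carrier_completion by blast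
    obtain k where "ip_dist Hc (completion_embed H (u k)) X < r"
      using LIMSEQ_D[OF embed_tendsto[OF u(1)] r] u(2) by fastforce
    then show ?thesis
      using u X u(1)[THEN CauD] embed_closed C.M.commute by (intro bexI[of _ "completion_embed H (u k)"]) auto
  qed
  then show ?thesis unfolding ip_topology_def C.M.metric_closure_of by auto
qed

theorem hilbert_completion: "complex_hilbert_space Hc"
proof -
  interpret C: complex_ip_space Hc by (rule ip_space_completion)
  have "\<exists>X. limitin C.M.mtopology \<sigma> X sequentially" if \<sigma>: "C.M.MCauchy \<sigma>" for \<sigma>
  proof -
    have "\<exists>x\<in>S. ip_dist Hc (completion_embed H x) (\<sigma> n) < 1 / real (Suc n)" for n
    proof -
      have "\<sigma> n \<in> ip_carrier Hc" using C.CauD[OF \<sigma>] .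
      then obtain u where u: "Cau u" "\<sigma> n = cls u" using carrier_completion by blast
      show ?thesis
        using LIMSEQ_D[OF embed_tendsto[OF u(1)], of "1 / real (Suc n)"] u u(1)[THEN CauD] by fastforce
    qed
    then obtain x where x: "\<And>n. x n \<in> S"
      "\<And>n. ip_dist Hc (completion_embed H (x n)) (\<sigma> n) < 1 / real (Suc n)" by metis
    have n0: "(\<lambda>n. ip_dist Hc (completion_embed H (x n)) (\<sigma> n)) \<longlonglongrightarrow> 0"
      using x(2) LIMSEQ_inverse_real_of_nat
      by (intro tendsto_sandwich[OF _ _ tendsto_const LIMSEQ_inverse_real_of_nat])
         (auto intro!: always_eventually less_imp_le simp: inverse_eq_divide)
    have "Cau x"
      unfolding M.MCauchy_def
    proof (intro conjI allI impI)
      show "range x \<subseteq> S" using x by auto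
      fix e :: real assume e: "e > 0"
      then obtain N1 where N1: "\<And>n. n \<ge> N1 \<Longrightarrow> ip_dist Hc (completion_embed H (x n)) (\<sigma> n) < e / 3"
        using LIMSEQ_D[OF n0, of "e / 3"] by auto
      obtain N2 where N2: "\<And>m n. N2 \<le> m \<Longrightarrow> N2 \<le> n \<Longrightarrow> ip_dist Hc (\<sigma> m) (\<sigma> n) < e / 3"
        using C.CauE[OF \<sigma>, of "e / 3"] e by auto
      have "ip_dist H (x m) (x n) < e" if "max N1 N2 \<le> m" "max N1 N2 \<le> n" for m n
      proof -
        let ?a = "completion_embed H (x m)" and ?b = "completion_embed H (x n)"
        have c: "?a \<in> ip_carrier Hc" "?b \<in> ip_carrier Hc" "\<sigma> m \<in> ip_carrier Hc" "\<sigma> n \<in> ip_carrier Hc"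
          using x embed_closed C.CauD[OF \<sigma>] by auto
        have "ip_dist Hc ?a ?b \<le> ip_dist Hc ?a (\<sigma> m) + ip_dist Hc (\<sigma> m) ?b"
             "ip_dist Hc (\<sigma> m) ?b \<le> ip_dist Hc (\<sigma> m) (\<sigma> n) + ip_dist Hc (\<sigma> n) ?b"
          using c by (auto intro: C.M.triangle)
        then show ?thesis
          using N1[of m] N1[of n] N2[of m n] that C.M.commute[of "\<sigma> n" ?b] embed_dist[of "x m" "x n"] x
          by simp
      qed
      then show "\<exists>N. \<forall>n n'. N \<le> n \<longrightarrow> N \<le> n' \<longrightarrow> ip_dist H (x n) (x n') < e" by blast
    qed
    then have X: "cls x \<in> ip_carrier Hc" using carrier_completion by blast
    have lim: "(\<lambda>n. ip_dist Hc (completion_embed H (x n)) (\<sigma> n)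
        + ip_dist Hc (completion_embed H (x n)) (cls x)) \<longlonglongrightarrow> 0"
      using tendsto_add[OF n0 embed_tendsto[OF \<open>Cau x\<close>]] by simp
    have "norm (ip_dist Hc (\<sigma> n) (cls x)) \<le> ip_dist Hc (completion_embed H (x n)) (\<sigma> n)
        + ip_dist Hc (completion_embed H (x n)) (cls x)" for n
      using C.M.triangle[OF C.CauD[OF \<sigma>, of n] embed_closed[OF x(1), of n] X]
        C.M.commute[of "\<sigma> n" "completion_embed H (x n)"] by simp
    then have "(\<lambda>n. ip_dist Hc (\<sigma> n) (cls x)) \<longlonglongrightarrow> 0"
      by (intro Lim_null_comparison[OF always_eventually lim] allI)
    then show ?thesis
      unfolding C.M.limitin_metric_dist_null using X C.CauD[OF \<sigma>] by (intro exI conjI) simp_all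
  qed
  then have "C.M.mcomplete" unfolding C.M.mcomplete_def by blast
  then show ?thesis
    by (intro complex_hilbert_space.intro complex_hilbert_space_axioms.intro ip_space_completion)
qed

end

context anti_dual_pair
begin

lemma hermitian:
  assumes "positive_operator scaleE scaleF pair A"
  shows "pair (A y) x = cnj (pair (A x) y)"
proof -
  interpret A: Vector_Spaces.linear scaleE scaleF A
    using assms by (simp add: positive_operator_def)
  have pos: "Im (pair (A z) z) = 0" for z
    using assms unfolding positive_operator_def by (metis Reals_cases nonneg_Reals_Real Im_complex_of_real)
  have "Im (pair (A x) y) + Im (pair (A y) x) = 0"
    using pos[of "x + y"] pos[of x] pos[of y] by (simp add: A.add pair_add_left pair_add_right)
  moreover have "Re (pair (A y) x) = Re (pair (A x) y)"
    using pos[of "x + scaleE \<i> y"] pos[of x] pos[of y]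
    by (simp add: A.add A.scale pair_add_left pair_add_right pair_scale_left pair_scale_right)
  ultimately show ?thesis by (simp add: complex_eq_iff)
qed

lemma range_space_inner:
  assumes "positive_operator scaleE scaleF pair A"
  shows "ip_inner (range_space scaleF pair A) (A x) (A y) = pair (A x) y"
proof -
  have "A (inv A (A y)) = A y" by (simp add: f_inv_into_f)
  then show ?thesis by (simp add: range_space_def) (metis hermitian[OF assms])
qed

lemma pair_zero: "pair 0 x = 0"
  using pair_add_left[of 0 0 x] by simp

lemma positive_definite:
  assumes A: "positive_operator scaleE scaleF pair A" and x: "pair (A x) x = 0"
  shows "A x = 0"
proof (rule ccontr)
  interpret A: Vector_Spaces.linear scaleE scaleF A
    using A by (simp add: positive_operator_def)
  have pos: "pair (A z) z \<in> \<real>\<^sub>\<ge>\<^sub>0" for z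
    using A by (simp add: positive_operator_def)
  assume "A x \<noteq> 0"
  then obtain y where y: "pair (A x) y \<noteq> pair 0 y" using pair_separates_F[of "A x" 0] by metis
  define q where "q = pair (A x) y"
  have "cmod q > 0" using y by (simp add: q_def pair_zero)
  have yx: "pair (A y) x = cnj q" unfolding q_def by (rule hermitian[OF A])
  obtain b where b: "pair (A y) y = of_real b" "b \<ge> 0"
    using pos[of y] by (rule nonneg_Reals_cases)
  define t where "t = 1 / (b + 1)"
  have t: "t > 0" "t * b < 1" unfolding t_def using b(2) by simp_all
  let ?z = "x + scaleE (- of_real t * q) y"
  have "pair (A ?z) ?z = - 2 * of_real t * (q * cnj q) + (of_real t)\<^sup>2 * (q * cnj q) * of_real b"
    by (simp only: A.add A.scale pair_add_left pair_add_right pair_scale_left pair_scale_right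
        x yx b(1) q_def[symmetric] complex_cnj_mult complex_cnj_minus complex_cnj_complex_of_real)
      (simp add: algebra_simps power2_eq_square)
  also have "\<dots> = of_real (t * (cmod q)\<^sup>2 * (t * b - 2))"
    unfolding complex_norm_square[symmetric] by (simp add: algebra_simps power2_eq_square)
  finally have eq: "pair (A ?z) ?z = of_real (t * (cmod q)\<^sup>2 * (t * b - 2))" .
  have "0 \<le> t * (cmod q)\<^sup>2 * (t * b - 2)"
    using pos[of ?z] unfolding eq nonneg_Reals_of_real_iff .
  moreover have "t * (cmod q)\<^sup>2 * (t * b - 2) < 0"
    using t \<open>cmod q > 0\<close> by (intro mult_pos_neg) auto
  ultimately show False by linarith
qed

lemma ip_space_range_space:
  assumes A: "positive_operator scaleE scaleF pair A"
  shows "complex_ip_space (range_space scaleF pair A)"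
proof -
  interpret A: Vector_Spaces.linear scaleE scaleF A
    using assms by (simp add: positive_operator_def)
  let ?R = "range_space scaleF pair A"
  have R: "ip_carrier ?R = range A" "ip_add ?R = (+)" "ip_zero ?R = 0" "ip_scale ?R = scaleF"
    by (simp_all add: range_space_def)
  have add: "f + g \<in> range A" if "f \<in> range A" "g \<in> range A" for f g
    using that by (elim imageE) (simp only: A.add[symmetric] rangeI)
  have scale: "scaleF c f \<in> range A" if "f \<in> range A" for c f
    using that by (elim imageE) (simp only: A.scale[symmetric] rangeI)
  have zero: "0 \<in> range A"
    using rangeI[of A 0] by simp
  have inner: "ip_inner ?R f (A y) = pair f y" if "f \<in> range A" for f y
    using that by (elim imageE) (simp only: range_space_inner[OF A])
  show ?thesis
  proof (rule complex_ip_space.intro, unfold R)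
    show "ip_inner ?R (f + g) h = ip_inner ?R f h + ip_inner ?R g h"
      if f: "f \<in> range A" and g: "g \<in> range A" and "h \<in> range A" for f g h
    proof -
      obtain z where "h = A z" using \<open>h \<in> range A\<close> by (rule imageE)
      then show ?thesis by (simp only: inner[OF f] inner[OF g] inner[OF add[OF f g]] pair_add_left)
    qed
    show "ip_inner ?R (scaleF c f) g = c * ip_inner ?R f g"
      if f: "f \<in> range A" and "g \<in> range A" for f g c
    proof -
      obtain z where "g = A z" using \<open>g \<in> range A\<close> by (rule imageE)
      then show ?thesis by (simp only: inner[OF f] inner[OF scale[OF f]] pair_scale_left)
    qed
    show "ip_inner ?R g f = cnj (ip_inner ?R f g)"
      if f: "f \<in> range A" and g: "g \<in> range A" for f g
    proof -
      obtain x where "f = A x" using f by (rule imageE)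
      moreover obtain y where "g = A y" using g by (rule imageE)
      ultimately show ?thesis
        by (simp only: range_space_inner[OF A]) (rule hermitian[OF A])
    qed
    show "ip_inner ?R f f \<in> \<real>\<^sub>\<ge>\<^sub>0" if f: "f \<in> range A" for f
    proof -
      obtain x where "f = A x" using f by (rule imageE)
      then show ?thesis using range_space_inner[OF A] A by (simp add: positive_operator_def)
    qed
    show "f = 0" if f: "f \<in> range A" and 0: "ip_inner ?R f f = 0" for f
    proof -
      obtain x where "f = A x" using f by (rule imageE)
      then show ?thesis using range_space_inner[OF A] positive_definite[OF A] 0 by simp
    qed
    show "f + g = g + f" for f g :: 'f by (rule add.commute)
    show "f + g + h = f + (g + h)" for f g h :: 'f by (rule add.assoc)
  qed (simp_all add: add scale zero F.scale_right_distrib F.scale_left_distrib)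
qed

theorem hilbert_aux_space:
  assumes "positive_operator scaleE scaleF pair A"
  shows "complex_hilbert_space (aux_space scaleF pair A)"
  unfolding aux_space_def
  by (rule complex_ip_space.hilbert_completion[OF ip_space_range_space[OF assms]])

end

end

theory Submission
  imports Defs
begin

text \<open>
  The vectors of \<open>H\<^sub>A\<close> are limits of \<open>A x\<^sub>n\<close> for sequences that are Cauchy in the seminorm
  \<open>\<langle>A x, x\<rangle>\<^sup>1\<^sup>/\<^sup>2\<close>, and sequential completeness gives \<open>\<langle>J\<^sub>A \<xi>, x\<rangle> = (\<xi> | A x)\<^sub>A\<close>.  By the
  parallelogram law a minimising sequence \<open>y\<^sub>n\<close> for the infimum defining the parallel sum \<open>D\<close> at
  \<open>x\<close> is Cauchy for both seminorms, and by the Euler equation \<open>A (x - y\<^sub>n)\<close> and \<open>B y\<^sub>n\<close> have the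
  same limit \<open>D x\<close>.  Hence \<open>D x\<close> lies in both \<open>ran J\<^sub>A\<close> and \<open>ran J\<^sub>B\<close>, and \<open>D \<le> A\<close>, \<open>D \<le> B\<close>: each
  of (i), (iv), (vi) forces \<open>D = 0\<close>, without the Riesz representation theorem.  The equation
  \<open>D = 0\<close> is (vii), which yields the other assertions by continuity; for (vi), a nonzero
  \<open>f\<close> in both ranges makes a small multiple of the rank one operator \<open>x \<mapsto> \<langle>f, x\<rangle>\<^sup>* f\<close> a common
  lower bound of \<open>A\<close> and \<open>B\<close>.
\<close>

section \<open>Weak topologies\<close>

lemma topspace_weak_topology:
  assumes "\<Phi> \<noteq> {}"
  shows "topspace (weak_topology S \<Phi>) = S"
proof -
  obtain \<phi> where "\<phi> \<in> \<Phi>" using assms by blast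
  then have "S \<in> {{x \<in> S. \<phi> x \<in> U} |\<phi> U. \<phi> \<in> \<Phi> \<and> open U}"
    by (intro CollectI exI[of _ \<phi>] exI[of _ UNIV]) simp
  then show ?thesis
    unfolding weak_topology_def topology_generated_by_topspace by blast
qed

lemma continuous_map_weak_topology:
  assumes "\<phi> \<in> \<Phi>"
  shows "continuous_map (weak_topology S \<Phi>) euclidean \<phi>"
proof -
  have "openin (weak_topology S \<Phi>) {x \<in> S. \<phi> x \<in> U}" if "open U" for U
    unfolding weak_topology_def
    by (rule topology_generated_by_Basis) (use assms that in blast)
  moreover have "topspace (weak_topology S \<Phi>) = S"
    using assms by (intro topspace_weak_topology) blast
  ultimately show ?thesis
    by (simp add: continuous_map_def)
qed

lemma continuous_map_into_weak_topology:
  assumes "\<Phi> \<noteq> {}" "f \<in> topspace X \<rightarrow> S"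
    and "\<And>\<phi>. \<phi> \<in> \<Phi> \<Longrightarrow> continuous_map X euclidean (\<lambda>x. \<phi> (f x))"
  shows "continuous_map X (weak_topology S \<Phi>) f"
  unfolding weak_topology_def
proof (rule continuous_on_generated_topo)
  fix V assume "V \<in> {{x \<in> S. \<phi> x \<in> U} |\<phi> U. \<phi> \<in> \<Phi> \<and> open U}"
  then obtain \<phi> U where V: "V = {x \<in> S. \<phi> x \<in> U}" "\<phi> \<in> \<Phi>" "open U" by blast
  have "f -` V \<inter> topspace X = {x \<in> topspace X. \<phi> (f x) \<in> U}"
    using assms(2) by (auto simp: V(1))
  then show "openin X (f -` V \<inter> topspace X)"
    using openin_continuous_map_preimage[OF assms(3)[OF V(2)]] V(3) by simp
next
  show "f ` topspace X \<subseteq> \<Union> {{x \<in> S. \<phi> x \<in> U} |\<phi> U. \<phi> \<in> \<Phi> \<and> open U}"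
    using assms(2) topspace_weak_topology[OF assms(1), of S]
    unfolding weak_topology_def topology_generated_by_topspace by blast
qed

text \<open>Convergence against each functional puts the sequence eventually into every subbasic set
  around the limit. Finite intersections and unions preserve this, which is the induction over the
  generated open sets.\<close>

lemma limitin_weak_topology:
  assumes "\<Phi> \<noteq> {}" "l \<in> S" "\<And>n. u n \<in> S"
    and lim: "\<And>\<phi>. \<phi> \<in> \<Phi> \<Longrightarrow> (\<lambda>n. \<phi> (u n)) \<longlonglongrightarrow> \<phi> l"
  shows "limitin (weak_topology S \<Phi>) u l sequentially"
  unfolding limitin_def
proof (intro conjI allI impI)
  show "l \<in> topspace (weak_topology S \<Phi>)"
    using assms topspace_weak_topology by blast
  fix U assume "openin (weak_topology S \<Phi>) U \<and> l \<in> U"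
  then have "generate_topology_on {{x \<in> S. \<phi> x \<in> U} |\<phi> U. \<phi> \<in> \<Phi> \<and> open U} U" "l \<in> U"
    by (simp_all add: weak_topology_def openin_topology_generated_by)
  then show "eventually (\<lambda>n. u n \<in> U) sequentially"
  proof (induction rule: generate_topology_on.induct)
    case (Int a b)
    then show ?case by (simp add: eventually_conj)
  next
    case (UN K)
    then obtain k where "k \<in> K" "eventually (\<lambda>n. u n \<in> k) sequentially" by blast
    then show ?case by (auto elim: eventually_mono)
  next
    case (Basis s)
    then obtain \<phi> V where V: "s = {x \<in> S. \<phi> x \<in> V}" "\<phi> \<in> \<Phi>" "open V" by blast
    then have "eventually (\<lambda>n. \<phi> (u n) \<in> V) sequentially"
      using Basis.prems by (intro topological_tendstoD[OF lim]) auto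
    then show ?case by (simp add: V(1) assms(3))
  qed simp
qed

section \<open>The weak topologies of an anti-dual pair\<close>

lemma continuous_map_sigma_FE: "continuous_map (sigma_FE pair) euclidean (\<lambda>f. pair f x)"
  unfolding sigma_FE_def by (rule continuous_map_weak_topology) blast

lemma continuous_map_sigma_EF: "continuous_map (sigma_EF pair) euclidean (\<lambda>x. pair f x)"
  unfolding sigma_EF_def by (rule continuous_map_weak_topology) blast

lemma continuous_map_into_sigma_FE:
  assumes "\<And>x. continuous_map X euclidean (\<lambda>t. pair (f t) x)"
  shows "continuous_map X (sigma_FE pair) f"
  unfolding sigma_FE_def by (rule continuous_map_into_weak_topology) (use assms in auto)

context anti_dual_pair
begin

lemma pair_minus_left: "pair (- f) x = - pair f x"
  using pair_add_left[of f "- f" x] pair_zero[of x] by (simp add: add_eq_0_iff)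

lemma pair_diff_left: "pair (f - g) x = pair f x - pair g x"
  using pair_add_left[of f "- g" x] by (simp add: pair_minus_left)

lemma pair_zero_right: "pair f 0 = 0"
  using pair_add_right[of f 0 0] by simp

lemma pair_minus_right: "pair f (- x) = - pair f x"
  using pair_add_right[of f x "- x"] pair_zero_right[of f] by (simp add: add_eq_0_iff)

lemma pair_diff_right: "pair f (x - y) = pair f x - pair f y"
  using pair_add_right[of f x "- y"] by (simp add: pair_minus_right)

lemma pair_eqI: "(\<And>x. pair f x = pair g x) \<Longrightarrow> f = g"
  using pair_separates_F by blast

text \<open>This is how sequential completeness enters: a sequence whose pairings all converge is
  weak-* Cauchy, so the pointwise limit \<open>c\<close> is represented by a vector.\<close>

lemma weak_star_limit:
  assumes complete: "weak_star_sequentially_complete pair"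
    and lim: "\<And>x. (\<lambda>n. pair (u n) x) \<longlonglongrightarrow> c x"
  shows "\<exists>f. \<forall>x. pair f x = c x"
proof -
  have "weak_star_Cauchy pair u"
    unfolding weak_star_Cauchy_def
  proof (intro allI impI)
    fix U assume "openin (sigma_FE pair) U \<and> 0 \<in> U"
    then have "generate_topology_on {{f \<in> UNIV. \<phi> f \<in> V} |\<phi> V. \<phi> \<in> {\<lambda>f. pair f x |x. True} \<and> open V} U"
      "0 \<in> U"
      unfolding sigma_FE_def weak_topology_def by (simp_all add: openin_topology_generated_by)
    then show "\<exists>N. \<forall>m\<ge>N. \<forall>n\<ge>N. u m - u n \<in> U"
    proof (induction rule: generate_topology_on.induct)
      case (Int a b)
      then obtain N N' where "\<And>m n. m \<ge> N \<Longrightarrow> n \<ge> N \<Longrightarrow> u m - u n \<in> a"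
        "\<And>m n. m \<ge> N' \<Longrightarrow> n \<ge> N' \<Longrightarrow> u m - u n \<in> b" by blast
      then show ?case by (intro exI[of _ "max N N'"]) auto
    next
      case (UN K)
      then show ?case by blast
    next
      case (Basis s)
      then obtain x V where V: "s = {f. pair f x \<in> V}" "open V" by auto
      then have "0 \<in> V" using Basis.prems by (simp add: pair_zero)
      then obtain e where e: "e > 0" "\<And>z. dist z 0 < e \<Longrightarrow> z \<in> V"
        using V(2) unfolding open_dist by blast
      \<comment> \<open>For a subbasic neighbourhood of 0 only one pairing matters; the difference
        of two of its late values lies in the ball of radius \<open>e\<close> inside
        \<open>V\<close>.\<close>
      have "Cauchy (\<lambda>n. pair (u n) x)"
        using lim[of x] by (rule LIMSEQ_imp_Cauchy)
      then obtain N where "\<And>m n. m \<ge> N \<Longrightarrow> n \<ge> N \<Longrightarrow> dist (pair (u m) x) (pair (u n) x) < e"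
        using e(1) unfolding Cauchy_def by blast
      then show ?case
        by (intro exI[of _ N]) (simp add: V(1) pair_diff_left e(2) dist_norm)
    qed simp
  qed
  then obtain f where f: "limitin (sigma_FE pair) u f sequentially"
    using complete unfolding weak_star_sequentially_complete_def by blast
  have "(\<lambda>n. pair (u n) x) \<longlonglongrightarrow> pair f x" for x
    using continuous_map_limit[OF continuous_map_sigma_FE[of pair x] f] by (simp add: o_def)
  then show ?thesis using lim LIMSEQ_unique by blast
qed

end

section \<open>The Hilbert space of a positive operator\<close>

text \<open>Both arguments may vary. Bounding the norm of \<open>u n\<close> by its distance from
  \<open>x\<close> plus the norm of \<open>x\<close> gives an explicit null sequence as majorant and
  replaces a boundedness argument.\<close>

lemma (in complex_ip_space) inner_tendsto:
  assumes "\<And>n. u n \<in> S" "x \<in> S" "(\<lambda>n. ip_dist H (u n) x) \<longlonglongrightarrow> 0"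
    and "\<And>n. v n \<in> S" "y \<in> S" "(\<lambda>n. ip_dist H (v n) y) \<longlonglongrightarrow> 0"
  shows "(\<lambda>n. ip (u n) (v n)) \<longlonglongrightarrow> ip x y"
proof -
  have "(\<lambda>n. ip_dist H (u n) x * nrm y + (ip_dist H (u n) x + nrm x) * ip_dist H (v n) y)
      \<longlonglongrightarrow> 0 * nrm y + (0 + nrm x) * 0"
    by (intro tendsto_intros assms)
  then have lim: "(\<lambda>n. ip_dist H (u n) x * nrm y + (ip_dist H (u n) x + nrm x) * ip_dist H (v n) y)
      \<longlonglongrightarrow> 0" by simp
  have "cmod (ip (u n) (v n) - ip x y)
      \<le> ip_dist H (u n) x * nrm y + (ip_dist H (u n) x + nrm x) * ip_dist H (v n) y" for n
  proof -
    have split: "a = ip_add H (df a b) b" if "a \<in> S" "b \<in> S" for a b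
      using that by (intro eq_by_inner) (simp_all add: inner_add_left inner_diff_left add_closed diff_closed)
    have u: "nrm (u n) \<le> ip_dist H (u n) x + nrm x"
      using norm_add[of "df (u n) x" x] split[of "u n" x] assms by (simp add: dist_eq diff_closed)
    have "ip (u n) (v n) - ip x y = ip (df (u n) x) y + ip (u n) (df (v n) y)"
      using assms by (simp add: inner_diff_left inner_diff_right)
    then have "cmod (ip (u n) (v n) - ip x y) \<le> cmod (ip (df (u n) x) y) + cmod (ip (u n) (df (v n) y))"
      by (simp add: norm_triangle_ineq)
    also have "\<dots> \<le> nrm (df (u n) x) * nrm y + nrm (u n) * nrm (df (v n) y)"
      using assms by (intro add_mono Cauchy_Schwarz) (simp_all add: diff_closed)
    also have "\<dots> \<le> ip_dist H (u n) x * nrm y + (ip_dist H (u n) x + nrm x) * ip_dist H (v n) y"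
      using assms u unfolding dist_eq[OF assms(1,2)] dist_eq[OF assms(4,5)]
      by (intro add_mono mult_right_mono) (simp_all add: norm_nonneg diff_closed)
    finally show ?thesis .
  qed
  then have "(\<lambda>n. ip (u n) (v n) - ip x y) \<longlonglongrightarrow> 0"
    by (intro Lim_null_comparison[OF always_eventually lim] allI)
  then show ?thesis by (simp add: LIM_zero_iff)
qed

locale positive_op = anti_dual_pair scaleE scaleF pair
  for scaleE :: "complex \<Rightarrow> 'e::ab_group_add \<Rightarrow> 'e"
    and scaleF :: "complex \<Rightarrow> 'f::ab_group_add \<Rightarrow> 'f"
    and pair :: "'f \<Rightarrow> 'e \<Rightarrow> complex" +
  fixes A :: "'e \<Rightarrow> 'f"
  assumes positive: "positive_operator scaleE scaleF pair A"
begin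

sublocale lin: Vector_Spaces.linear scaleE scaleF A
  using positive by (simp add: positive_operator_def)

sublocale R: complex_ip_space "range_space scaleF pair A"
  by (rule ip_space_range_space[OF positive])

abbreviation "H \<equiv> aux_space scaleF pair A"
abbreviation "emb x \<equiv> aux_embed scaleF pair A (A x)"
abbreviation "J \<equiv> aux_J scaleF pair A"
abbreviation "q x \<equiv> Re (pair (A x) x)"

sublocale H: complex_ip_space H
  unfolding aux_space_def by (rule R.ip_space_completion)

lemma carrier_range: "ip_carrier (range_space scaleF pair A) = range A"
  by (simp add: range_space_def)

lemma emb_closed: "emb x \<in> ip_carrier H"
  unfolding aux_space_def aux_embed_def by (rule R.embed_closed) (simp add: carrier_range)

lemma emb_add: "emb (x + y) = ip_add H (emb x) (emb y)"
  using R.embed_add[of "A x" "A y"]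
  unfolding aux_space_def aux_embed_def by (simp add: range_space_def lin.add)

lemma emb_scale: "emb (scaleE c x) = ip_scale H c (emb x)"
  using R.embed_scale[of "A x" c]
  unfolding aux_space_def aux_embed_def by (simp add: range_space_def lin.scale)

lemma inner_emb: "ip_inner H (emb x) (emb y) = pair (A x) y"
  using R.embed_inner[of "A x" "A y"] range_space_inner[OF positive, of x y]
  unfolding aux_space_def aux_embed_def by (simp add: carrier_range)

lemma emb_zero: "emb 0 = ip_zero H"
proof (rule H.inner_definite[OF emb_closed])
  show "ip_inner H (emb 0) (emb 0) = 0"
    unfolding inner_emb by (rule pair_zero_right)
qed

section \<open>The quadratic form of a positive operator and its seminorm\<close>

lemma pair_self: "pair (A x) x = of_real (q x)"
  using positive unfolding positive_operator_def
  by (metis nonneg_Reals_cases Re_complex_of_real)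

lemma q_nonneg: "0 \<le> q x"
  using positive unfolding positive_operator_def
  by (metis nonneg_Reals_cases Re_complex_of_real)

lemma norm_emb: "ip_norm H (emb x) = sqrt (q x)"
  by (simp add: ip_norm_def inner_emb)

lemma dist_emb: "ip_dist H (emb x) (emb y) = sqrt (q (x - y))"
proof -
  have "ip_diff H (emb x) (emb y) = emb (x - y)"
    by (rule H.eq_by_inner)
      (auto simp: H.diff_closed emb_closed H.inner_diff_left
         H.inner_add_left[symmetric] emb_add[symmetric] diff_eq_eq)
  then show ?thesis by (simp add: H.dist_eq emb_closed norm_emb)
qed

lemma Cauchy_Schwarz_pair: "(cmod (pair (A x) y))\<^sup>2 \<le> q x * q y"
proof -
  have "cmod (pair (A x) y) \<le> sqrt (q x) * sqrt (q y)"
    using H.Cauchy_Schwarz[OF emb_closed emb_closed, of x y] by (simp add: inner_emb norm_emb)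
  then have "(cmod (pair (A x) y))\<^sup>2 \<le> (sqrt (q x) * sqrt (q y))\<^sup>2"
    by (intro power_mono) auto
  then show ?thesis by (simp add: power_mult_distrib q_nonneg)
qed

lemma q_triangle: "sqrt (q (x + y)) \<le> sqrt (q x) + sqrt (q y)"
  using H.norm_add[OF emb_closed emb_closed, of x y] by (simp add: emb_add[symmetric] norm_emb)

lemma q_add: "q (x + y) = q x + q y + 2 * Re (pair (A x) y)"
  by (simp add: lin.add pair_add_left pair_add_right hermitian[OF positive, of y x])

lemma q_scale: "q (scaleE c x) = (cmod c)\<^sup>2 * q x"
proof -
  have "pair (A (scaleE c x)) (scaleE c x) = (c * cnj c) * pair (A x) x"
    by (simp add: lin.scale pair_scale_left pair_scale_right)
  also have "\<dots> = of_real ((cmod c)\<^sup>2 * q x)"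
    unfolding complex_norm_square[symmetric] by (subst pair_self) simp
  finally show ?thesis by simp
qed

text \<open>The parallelogram law solved for the midpoint: the deficit \<open>q (x - y) / 4\<close>
  is what later forces minimising sequences to be Cauchy.\<close>

lemma q_midpoint: "q (scaleE (1 / 2) (x + y)) = (q x + q y) / 2 - q (x - y) / 4"
proof -
  have "q (x - y) = q x + q y - 2 * Re (pair (A x) y)"
    by (simp add: lin.diff pair_diff_left pair_diff_right hermitian[OF positive, of y x])
  moreover have "q (scaleE (1 / 2) (x + y)) = (q x + q y + 2 * Re (pair (A x) y)) / 4"
    unfolding q_scale q_add by (simp add: power2_eq_square)
  ultimately show ?thesis by (simp add: field_simps)
qed

text \<open>Hermitian symmetry turns \<open>pair (A y) x\<close> into the conjugate of
  \<open>pair (A x) y\<close>, whose dependence on \<open>y\<close> is one of the functionals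
  defining the weak topology of the domain.\<close>

lemma weakly_continuous: "A \<in> weakly_continuous_operators scaleE scaleF pair"
proof -
  have "continuous_map (sigma_EF pair) euclidean (\<lambda>y. cnj (pair (A x) y))" for x
    using continuous_map_compose[OF continuous_map_sigma_EF, of euclidean cnj pair "A x"]
    by (simp add: o_def continuous_on_cnj)
  then have "continuous_map (sigma_EF pair) euclidean (\<lambda>y. pair (A y) x)" for x
    unfolding hermitian[OF positive, of _ x] .
  then have "continuous_map (sigma_EF pair) (sigma_FE pair) A"
    by (rule continuous_map_into_sigma_FE)
  then show ?thesis
    by (simp add: weakly_continuous_operators_def lin.linear_axioms)
qed

section \<open>Vectors of the Hilbert space as norm limits of embedded sequences\<close>

definition approx :: "(nat \<Rightarrow> 'e) \<Rightarrow> (nat \<Rightarrow> 'f) set \<Rightarrow> bool" where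
  "approx u \<xi> \<longleftrightarrow> \<xi> \<in> ip_carrier H \<and> (\<lambda>n. ip_dist H (emb (u n)) \<xi>) \<longlonglongrightarrow> 0"

text \<open>The limit is the class of the sequence \<open>A (u n)\<close> in the completion, to
  which its own embedded terms converge.\<close>

lemma approx_of_Cauchy:
  assumes "\<And>e. e > 0 \<Longrightarrow> \<exists>N. \<forall>m\<ge>N. \<forall>n\<ge>N. q (u m - u n) < e"
  shows "\<exists>\<xi>. approx u \<xi>"
proof -
  have dist: "ip_dist (range_space scaleF pair A) (A x) (A y) = sqrt (q (x - y))" for x y
    using R.embed_dist[of "A x" "A y"] dist_emb[of x y]
    unfolding aux_space_def aux_embed_def by (simp add: carrier_range)
  have "R.Cau (\<lambda>n. A (u n))"
    unfolding R.M.MCauchy_def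
  proof (intro conjI allI impI)
    show "range (\<lambda>n. A (u n)) \<subseteq> ip_carrier (range_space scaleF pair A)"
      by (auto simp: carrier_range)
    fix e :: real assume e: "e > 0"
    \<comment> \<open>The threshold is \<open>e\<^sup>2\<close> because distances are square roots
      of values of \<open>q\<close>.\<close>
    then obtain N where "\<And>m n. m \<ge> N \<Longrightarrow> n \<ge> N \<Longrightarrow> q (u m - u n) < e\<^sup>2"
      using assms[of "e\<^sup>2"] by auto
    then show "\<exists>N. \<forall>n n'. N \<le> n \<longrightarrow> N \<le> n' \<longrightarrow>
        ip_dist (range_space scaleF pair A) (A (u n)) (A (u n')) < e"
      using e by (intro exI[of _ N]) (simp add: dist real_less_lsqrt)
  qed
  from R.embed_tendsto[OF this] R.cls_closed[OF this] show ?thesis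
    unfolding approx_def aux_space_def aux_embed_def by blast
qed

text \<open>A class in the completion is represented by a Cauchy sequence in the range of
  \<open>A\<close>; preimages of its terms form \<open>u\<close>.\<close>

lemma approx_exists:
  assumes "\<xi> \<in> ip_carrier H"
  obtains u where "approx u \<xi>"
proof -
  obtain v where v: "R.Cau v" "\<xi> = R.cls v" "\<And>n. v n \<in> ip_carrier (range_space scaleF pair A)"
    using R.completion_cases[of \<xi>] assms unfolding aux_space_def by blast
  then have "\<forall>n. \<exists>x. v n = A x" by (auto simp: carrier_range)
  then obtain u where "\<And>n. v n = A (u n)" by metis
  then have "v = (\<lambda>n. A (u n))" by (intro ext)
  with R.embed_tendsto[OF v(1)] assms show ?thesis
    by (intro that[of u]) (simp add: approx_def aux_space_def aux_embed_def v(2))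
qed

lemma approxD:
  assumes "approx u \<xi>"
  shows "\<xi> \<in> ip_carrier H" "(\<lambda>n. ip_dist H (emb (u n)) \<xi>) \<longlonglongrightarrow> 0"
  using assms unfolding approx_def by blast+

lemma approx_inner:
  assumes "approx u \<xi>" "approx v \<eta>"
  shows "(\<lambda>n. pair (A (u n)) (v n)) \<longlonglongrightarrow> ip_inner H \<xi> \<eta>"
  using H.inner_tendsto[OF emb_closed approxD[OF assms(1)] emb_closed approxD[OF assms(2)]]
  unfolding inner_emb .

lemma approx_const: "approx (\<lambda>n. x) (emb x)"
  unfolding approx_def by (intro conjI emb_closed) (simp add: dist_emb pair_zero_right)

lemma approx_inner_left:
  assumes "approx u \<xi>"
  shows "(\<lambda>n. pair (A (u n)) x) \<longlonglongrightarrow> ip_inner H \<xi> (emb x)"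
  by (rule approx_inner[OF assms approx_const])

lemma approx_inner_right:
  assumes "approx u \<xi>" "\<eta> \<in> ip_carrier H"
  shows "(\<lambda>n. ip_inner H \<eta> (emb (u n))) \<longlonglongrightarrow> ip_inner H \<eta> \<xi>"
  by (rule H.inner_tendsto[OF assms(2,2) _ emb_closed approxD[OF assms(1)]])
    (simp add: assms(2))

lemma approx_add:
  assumes "approx u \<xi>" "approx v \<eta>"
  shows "approx (\<lambda>n. u n + v n) (ip_add H \<xi> \<eta>)"
proof -
  note c = assms[THEN approxD(1)]
  have "norm (ip_dist H (emb (u n + v n)) (ip_add H \<xi> \<eta>))
      \<le> ip_dist H (emb (u n)) \<xi> + ip_dist H (emb (v n)) \<eta>" for n
    using c H.norm_add[of "ip_diff H (emb (u n)) \<xi>" "ip_diff H (emb (v n)) \<eta>"]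
    by (simp add: emb_add H.dist_eq emb_closed H.add_closed H.diff_add H.diff_closed H.norm_nonneg)
  moreover have "(\<lambda>n. ip_dist H (emb (u n)) \<xi> + ip_dist H (emb (v n)) \<eta>) \<longlonglongrightarrow> 0"
    using tendsto_add[OF assms[THEN approxD(2)]] by simp
  ultimately have "(\<lambda>n. ip_dist H (emb (u n + v n)) (ip_add H \<xi> \<eta>)) \<longlonglongrightarrow> 0"
    by (rule Lim_null_comparison[OF always_eventually[OF allI]])
  then show ?thesis unfolding approx_def by (intro conjI H.add_closed c)
qed

lemma approx_scale:
  assumes "approx u \<xi>"
  shows "approx (\<lambda>n. scaleE c (u n)) (ip_scale H c \<xi>)"
proof -
  note c = approxD(1)[OF assms]
  have "ip_dist H (emb (scaleE c (u n))) (ip_scale H c \<xi>) = cmod c * ip_dist H (emb (u n)) \<xi>" for n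
    using c by (simp add: emb_scale H.dist_eq emb_closed H.scale_closed H.diff_scale H.diff_closed H.norm_scale)
  moreover have "(\<lambda>n. cmod c * ip_dist H (emb (u n)) \<xi>) \<longlonglongrightarrow> 0"
    using tendsto_mult_left[OF approxD(2)[OF assms], of "cmod c"] by simp
  ultimately show ?thesis unfolding approx_def by (simp add: c H.scale_closed)
qed

text \<open>Embedded vectors approximate every \<open>\<zeta>\<close>, and inner products pass to
  the limit.\<close>

lemma eq_by_emb:
  assumes "\<xi> \<in> ip_carrier H" "\<eta> \<in> ip_carrier H"
    and "\<And>x. ip_inner H \<xi> (emb x) = ip_inner H \<eta> (emb x)"
  shows "\<xi> = \<eta>"
proof (rule H.eq_by_inner[OF assms(1,2)])
  fix \<zeta> assume "\<zeta> \<in> ip_carrier H"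
  then obtain u where u: "approx u \<zeta>" by (rule approx_exists)
  have "(\<lambda>n. ip_inner H \<xi> (emb (u n))) \<longlonglongrightarrow> ip_inner H \<eta> \<zeta>"
    unfolding assms(3) by (rule approx_inner_right[OF u assms(2)])
  then show "ip_inner H \<xi> \<zeta> = ip_inner H \<eta> \<zeta>"
    using approx_inner_right[OF u assms(1)] LIMSEQ_unique by blast
qed

text \<open>So \<open>J\<close> is the adjoint of \<open>emb\<close>, and later computations with
  \<open>J\<close> rest on this formula. Weak-* limits of \<open>A (u n)\<close> provide a map with
  this property, and density of the range leaves no other candidate for \<open>J\<close>.\<close>

lemma aux_J_pair:
  assumes complete: "weak_star_sequentially_complete pair" and \<xi>: "\<xi> \<in> ip_carrier H"
  shows "pair (J \<xi>) x = ip_inner H \<xi> (emb x)"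
proof -
  have "\<exists>f. \<forall>x. pair f x = ip_inner H \<xi> (emb x)" if "\<xi> \<in> ip_carrier H" for \<xi>
  proof -
    obtain u where "approx u \<xi>" using \<open>\<xi> \<in> ip_carrier H\<close> by (rule approx_exists)
    then show ?thesis by (intro weak_star_limit[OF complete approx_inner_left])
  qed
  then obtain K0 where K0: "\<And>\<xi> x. \<xi> \<in> ip_carrier H \<Longrightarrow> pair (K0 \<xi>) x = ip_inner H \<xi> (emb x)"
    by metis
  \<comment> \<open>Restriction to the carrier meets the extensionality clause in the definition of
    \<open>aux_J\<close>.\<close>
  define K where "K = restrict K0 (ip_carrier H)"
  have K: "pair (K \<xi>) x = ip_inner H \<xi> (emb x)" if "\<xi> \<in> ip_carrier H" for \<xi> x
    using that K0 by (simp add: K_def)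
  have top: "topspace (ip_weak_topology H) = ip_carrier H"
    unfolding ip_weak_topology_def using H.zero_closed by (intro topspace_weak_topology) blast
  have "J = K"
    unfolding aux_J_def
  proof (rule the_equality, intro conjI ballI allI)
    show "K \<in> extensional (ip_carrier H)" by (simp add: K_def)
    show "K (ip_add H \<xi> \<eta>) = K \<xi> + K \<eta>" if "\<xi> \<in> ip_carrier H" "\<eta> \<in> ip_carrier H" for \<xi> \<eta>
      using that by (intro pair_eqI) (simp add: K H.add_closed pair_add_left H.inner_add_left emb_closed)
    show "K (ip_scale H c \<xi>) = scaleF c (K \<xi>)" if "\<xi> \<in> ip_carrier H" for c \<xi>
      using that by (intro pair_eqI) (simp add: K H.scale_closed pair_scale_left H.inner_scale_left emb_closed)
    show "K (aux_embed scaleF pair A f) = f" if "f \<in> range A" for f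
      using that by (elim imageE) (auto intro!: pair_eqI simp: K emb_closed inner_emb)
    show "continuous_map (ip_weak_topology H) (sigma_FE pair) K"
    proof (rule continuous_map_into_sigma_FE)
      fix x
      have "continuous_map (ip_weak_topology H) euclidean (\<lambda>\<xi>. ip_inner H \<xi> (emb x))"
        unfolding ip_weak_topology_def using emb_closed by (intro continuous_map_weak_topology) blast
      then show "continuous_map (ip_weak_topology H) euclidean (\<lambda>\<xi>. pair (K \<xi>) x)"
        by (rule continuous_map_eq) (simp add: top K)
    qed
  next
    fix L assume L: "L \<in> extensional (ip_carrier H) \<and>
      (\<forall>\<xi>\<in>ip_carrier H. \<forall>\<eta>\<in>ip_carrier H. L (ip_add H \<xi> \<eta>) = L \<xi> + L \<eta>) \<and>
      (\<forall>c. \<forall>\<xi>\<in>ip_carrier H. L (ip_scale H c \<xi>) = scaleF c (L \<xi>)) \<and>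
      continuous_map (ip_weak_topology H) (sigma_FE pair) L \<and>
      (\<forall>f\<in>range A. L (aux_embed scaleF pair A f) = f)"
    show "L = K"
    proof (rule extensionalityI)
      show "L \<in> extensional (ip_carrier H)" using L by blast
      show "K \<in> extensional (ip_carrier H)" by (simp add: K_def)
      fix \<xi> assume \<xi>: "\<xi> \<in> ip_carrier H"
      then obtain u where u: "approx u \<xi>" by (rule approx_exists)
      \<comment> \<open>Norm convergence implies weak convergence, so the weakly continuous
        \<open>L\<close> is determined by its values \<open>A (u n)\<close> on embedded
        vectors.\<close>
      have "limitin (ip_weak_topology H) (\<lambda>n. emb (u n)) \<xi> sequentially"
        unfolding ip_weak_topology_def
      proof (rule limitin_weak_topology)
        fix \<phi> assume "\<phi> \<in> {\<lambda>\<xi>. ip_inner H \<xi> \<eta> |\<eta>. \<eta> \<in> ip_carrier H}"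
        then obtain \<eta> where \<eta>: "\<eta> \<in> ip_carrier H" "\<phi> = (\<lambda>\<xi>. ip_inner H \<xi> \<eta>)" by blast
        show "(\<lambda>n. \<phi> (emb (u n))) \<longlonglongrightarrow> \<phi> \<xi>"
          unfolding \<eta>(2)
          by (rule H.inner_tendsto[OF emb_closed approxD[OF u] \<eta>(1,1)]) (simp add: \<eta>(1))
      qed (use \<xi> emb_closed H.zero_closed in auto)
      moreover have "continuous_map (ip_weak_topology H) (sigma_FE pair) L" using L by blast
      ultimately have *: "limitin (sigma_FE pair) (\<lambda>n. L (emb (u n))) (L \<xi>) sequentially"
        using continuous_map_limit by (fastforce simp: o_def)
      have "(\<lambda>n. pair (L (emb (u n))) x) \<longlonglongrightarrow> pair (L \<xi>) x" for x
        using continuous_map_limit[OF continuous_map_sigma_FE[of pair x] *] by (simp add: o_def)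
      then have "(\<lambda>n. pair (A (u n)) x) \<longlonglongrightarrow> pair (L \<xi>) x" for x
        using L by simp
      then have "pair (L \<xi>) x = pair (K \<xi>) x" for x
        using approx_inner_left[OF u, of x] LIMSEQ_unique K[OF \<xi>] by metis
      then show "L \<xi> = K \<xi>" by (rule pair_eqI)
    qed
  qed
  then show ?thesis using K \<xi> by simp
qed

end

section \<open>The parallel sum\<close>

locale positive_op_pair = anti_dual_pair scaleE scaleF pair
  for scaleE :: "complex \<Rightarrow> 'e::ab_group_add \<Rightarrow> 'e"
    and scaleF :: "complex \<Rightarrow> 'f::ab_group_add \<Rightarrow> 'f"
    and pair :: "'f \<Rightarrow> 'e \<Rightarrow> complex" +
  fixes A B :: "'e \<Rightarrow> 'f"
  assumes complete: "weak_star_sequentially_complete pair"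
    and positive_A: "positive_operator scaleE scaleF pair A"
    and positive_B: "positive_operator scaleE scaleF pair B"
begin

sublocale A: positive_op scaleE scaleF pair A
  by unfold_locales (rule positive_A)

sublocale B: positive_op scaleE scaleF pair B
  by unfold_locales (rule positive_B)

abbreviation "cost x y \<equiv> A.q (x - y) + B.q y"

text \<open>The equality of the two limits \<open>A.J \<xi>\<close> and \<open>B.J \<eta>\<close> is the Euler equation for the
  minimisation of \<open>cost x\<close>, so that \<open>f\<close> is the value at \<open>x\<close> of the parallel sum.\<close>

definition splits :: "'e \<Rightarrow> 'f \<Rightarrow> bool" where
  "splits x f \<longleftrightarrow> (\<exists>y \<xi> \<eta>. A.approx (\<lambda>n. x - y n) \<xi> \<and> B.approx y \<eta> \<and> A.J \<xi> = f \<and> B.J \<eta> = f)"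

lemma splitsI:
  assumes "A.approx (\<lambda>n. x - y n) \<xi>" "B.approx y \<eta>" "A.J \<xi> = f" "B.J \<eta> = f"
  shows "splits x f"
  unfolding splits_def by (intro exI conjI) (rule assms)+

text \<open>Write \<open>x\<close> as \<open>(x - y n) + y n\<close>: paired with \<open>f\<close>,
  the two parts tend to the squared norms of \<open>\<xi>\<close> and \<open>\<eta>\<close>, because
  \<open>f\<close> is the image of both, while their sum does not depend on
  \<open>n\<close>.\<close>

lemma splits_pair:
  assumes "A.approx (\<lambda>n. x - y n) \<xi>" "B.approx y \<eta>" "A.J \<xi> = f" "B.J \<eta> = f"
  shows "pair f x = ip_inner A.H \<xi> \<xi> + ip_inner B.H \<eta> \<eta>"
proof -
  have "(\<lambda>n. pair f (x - y n)) \<longlonglongrightarrow> ip_inner A.H \<xi> \<xi>"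
    using A.approx_inner_right[OF assms(1) A.approxD(1)[OF assms(1)]]
    unfolding A.aux_J_pair[OF complete A.approxD(1)[OF assms(1)], symmetric] assms(3) .
  moreover have "(\<lambda>n. pair f (y n)) \<longlonglongrightarrow> ip_inner B.H \<eta> \<eta>"
    using B.approx_inner_right[OF assms(2) B.approxD(1)[OF assms(2)]]
    unfolding B.aux_J_pair[OF complete B.approxD(1)[OF assms(2)], symmetric] assms(4) .
  ultimately have "(\<lambda>n. pair f (x - y n) + pair f (y n)) \<longlonglongrightarrow> ip_inner A.H \<xi> \<xi> + ip_inner B.H \<eta> \<eta>"
    by (rule tendsto_add)
  then show ?thesis by (simp add: pair_add_right[symmetric] LIMSEQ_const_iff)
qed

text \<open>All conditions in \<open>splits\<close> are linear. The linearity of the parallel sum,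
  which the infimum does not reveal, comes from here and from \<open>splits_scale\<close>.\<close>

lemma splits_add:
  assumes "splits x f" "splits x' f'"
  shows "splits (x + x') (f + f')"
proof -
  obtain y \<xi> \<eta> where y: "A.approx (\<lambda>n. x - y n) \<xi>" "B.approx y \<eta>" "A.J \<xi> = f" "B.J \<eta> = f"
    using assms(1) unfolding splits_def by blast
  obtain y' \<xi>' \<eta>' where y': "A.approx (\<lambda>n. x' - y' n) \<xi>'" "B.approx y' \<eta>'" "A.J \<xi>' = f'" "B.J \<eta>' = f'"
    using assms(2) unfolding splits_def by blast
  note c = A.approxD(1)[OF y(1)] A.approxD(1)[OF y'(1)]
  note d = B.approxD(1)[OF y(2)] B.approxD(1)[OF y'(2)]
  have "A.approx (\<lambda>n. x + x' - (y n + y' n)) (ip_add A.H \<xi> \<xi>')"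
    using A.approx_add[OF y(1) y'(1)] by (simp add: algebra_simps)
  moreover have "B.approx (\<lambda>n. y n + y' n) (ip_add B.H \<eta> \<eta>')"
    by (rule B.approx_add[OF y(2) y'(2)])
  moreover have "A.J (ip_add A.H \<xi> \<xi>') = f + f'"
    by (rule pair_eqI, unfold y(3)[symmetric] y'(3)[symmetric])
      (simp add: A.aux_J_pair[OF complete] c A.H.add_closed pair_add_left A.H.inner_add_left A.emb_closed)
  moreover have "B.J (ip_add B.H \<eta> \<eta>') = f + f'"
    by (rule pair_eqI, unfold y(4)[symmetric] y'(4)[symmetric])
      (simp add: B.aux_J_pair[OF complete] d B.H.add_closed pair_add_left B.H.inner_add_left B.emb_closed)
  ultimately show ?thesis by (rule splitsI)
qed

lemma splits_scale:
  assumes "splits x f"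
  shows "splits (scaleE c x) (scaleF c f)"
proof -
  obtain y \<xi> \<eta> where y: "A.approx (\<lambda>n. x - y n) \<xi>" "B.approx y \<eta>" "A.J \<xi> = f" "B.J \<eta> = f"
    using assms unfolding splits_def by blast
  have "A.approx (\<lambda>n. scaleE c x - scaleE c (y n)) (ip_scale A.H c \<xi>)"
    using A.approx_scale[OF y(1), of c] by (simp add: E.scale_right_diff_distrib)
  moreover have "B.approx (\<lambda>n. scaleE c (y n)) (ip_scale B.H c \<eta>)"
    by (rule B.approx_scale[OF y(2)])
  moreover have "A.J (ip_scale A.H c \<xi>) = scaleF c f"
    by (rule pair_eqI, unfold y(3)[symmetric])
      (simp add: A.aux_J_pair[OF complete] A.approxD(1)[OF y(1)] A.H.scale_closed pair_scale_left
        A.H.inner_scale_left A.emb_closed)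
  moreover have "B.J (ip_scale B.H c \<eta>) = scaleF c f"
    by (rule pair_eqI, unfold y(4)[symmetric])
      (simp add: B.aux_J_pair[OF complete] B.approxD(1)[OF y(2)] B.H.scale_closed pair_scale_left
        B.H.inner_scale_left B.emb_closed)
  ultimately show ?thesis by (rule splitsI)
qed

text \<open>By linearity \<open>f - g\<close> is a value at 0, where the squared norms of
  \<open>\<xi>\<close> and \<open>\<eta>\<close> add up to \<open>pair (f - g) 0 = 0\<close>. Hence
  \<open>\<xi>\<close> has norm zero and its image vanishes.\<close>

lemma splits_unique:
  assumes "splits x f" "splits x g"
  shows "f = g"
proof -
  have "splits (x + scaleE (- 1) x) (f + scaleF (- 1) g)"
    by (rule splits_add[OF assms(1) splits_scale[OF assms(2)]])
  then have "splits 0 (f - g)" by simp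
  then obtain y \<xi> \<eta> where y: "A.approx (\<lambda>n. 0 - y n) \<xi>" "B.approx y \<eta>" "A.J \<xi> = f - g" "B.J \<eta> = f - g"
    unfolding splits_def by blast
  note \<xi> = A.approxD(1)[OF y(1)]
  have "0 = ip_inner A.H \<xi> \<xi> + ip_inner B.H \<eta> \<eta>"
    using splits_pair[OF y] pair_zero_right by simp
  then have "(0::complex) = of_real ((ip_norm A.H \<xi>)\<^sup>2 + (ip_norm B.H \<eta>)\<^sup>2)"
    unfolding A.H.inner_self[OF \<xi>] B.H.inner_self[OF B.approxD(1)[OF y(2)]] by simp
  then have "(ip_norm A.H \<xi>)\<^sup>2 + (ip_norm B.H \<eta>)\<^sup>2 = 0"
    by (metis of_real_eq_0_iff)
  then have "ip_norm A.H \<xi> = 0" by (simp add: sum_power2_eq_zero_iff)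
  then have "pair (A.J \<xi>) z = 0" for z
    using A.H.Cauchy_Schwarz[OF \<xi> A.emb_closed[of z]] A.aux_J_pair[OF complete \<xi>, of z] by simp
  then have "pair (f - g) z = pair 0 z" for z
    by (simp only: y(3) pair_zero)
  then have "f - g = 0" by (rule pair_eqI)
  then show ?thesis by simp
qed

section \<open>Minimising sequences for the cost\<close>

lemma bdd_below_cost: "bdd_below (range (cost x))"
  using A.q_nonneg B.q_nonneg by (intro bdd_belowI[of _ 0]) (auto intro: add_nonneg_nonneg)

abbreviation "min_cost x \<equiv> (INF y. cost x y)"

lemma min_cost_le: "min_cost x \<le> cost x y"
  by (rule cINF_lower[OF bdd_below_cost]) simp

lemma min_cost_nonneg: "0 \<le> min_cost x"
  by (rule cINF_greatest) (simp_all add: A.q_nonneg B.q_nonneg)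

lemma near_min_cost:
  assumes "e > 0"
  shows "\<exists>y. cost x y < min_cost x + e"
  using cINF_less_iff[OF UNIV_not_empty bdd_below_cost[of x], of "min_cost x + e"] assms by simp

lemma minimizing_sequence: "\<exists>y. (\<lambda>n. cost x (y n)) \<longlonglongrightarrow> min_cost x"
proof -
  have "\<exists>y. \<forall>n. cost x (y n) < min_cost x + inverse (real (Suc n))"
    by (intro choice allI near_min_cost) simp
  then obtain y where y: "\<forall>n. cost x (y n) < min_cost x + inverse (real (Suc n))" ..
  have "(\<lambda>n. min_cost x + inverse (real (Suc n))) \<longlonglongrightarrow> min_cost x + 0"
    by (intro tendsto_add tendsto_const LIMSEQ_inverse_real_of_nat)
  then have lim: "(\<lambda>n. min_cost x + inverse (real (Suc n))) \<longlonglongrightarrow> min_cost x"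
    by simp
  have "(\<lambda>n. cost x (y n)) \<longlonglongrightarrow> min_cost x"
  proof (rule tendsto_sandwich[OF _ _ tendsto_const lim])
    show "\<forall>\<^sub>F n in sequentially. min_cost x \<le> cost x (y n)"
      by (intro always_eventually allI min_cost_le)
    show "\<forall>\<^sub>F n in sequentially. cost x (y n) \<le> min_cost x + inverse (real (Suc n))"
      by (intro always_eventually allI less_imp_le y[rule_format])
  qed
  then show ?thesis by (rule exI[of _ y])
qed

lemma q_minus: "A.q (- x) = A.q x" "B.q (- x) = B.q x"
  using A.q_scale[of "- 1" x] B.q_scale[of "- 1" x] by simp_all

text \<open>The midpoint of \<open>y\<close> and \<open>y'\<close> costs at least
  \<open>min_cost x\<close>; the parallelogram law for both forms turns this into a bound on the
  distance of two near minimisers.\<close>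

lemma cost_diff:
  "A.q (y - y') + B.q (y - y') \<le> 2 * (cost x y - min_cost x) + 2 * (cost x y' - min_cost x)"
proof -
  let ?m = "scaleE (1 / 2) (y + y')"
  have half: "scaleE (1 / 2) (x + x) = x"
    using E.scale_left_distrib[of "1 / 2" "1 / 2" x] by (simp add: E.scale_right_distrib)
  have "scaleE (1 / 2) ((x - y) + (x - y')) = scaleE (1 / 2) ((x + x) - (y + y'))"
    by (simp add: algebra_simps)
  also have "\<dots> = x - ?m"
    by (simp only: E.scale_right_diff_distrib half)
  finally have "A.q (x - ?m) = (A.q (x - y) + A.q (x - y')) / 2 - A.q ((x - y) - (x - y')) / 4"
    using A.q_midpoint[of "x - y" "x - y'"] by simp
  moreover have "A.q ((x - y) - (x - y')) = A.q (y - y')"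
    using q_minus(1)[of "y - y'"] by simp
  moreover have "B.q ?m = (B.q y + B.q y') / 2 - B.q (y - y') / 4"
    by (rule B.q_midpoint)
  ultimately show ?thesis using min_cost_le[of x ?m] by argo
qed

text \<open>Along a line the cost is a quadratic polynomial in \<open>t\<close>, whose linear
  coefficient must vanish in the limit of a minimising sequence.\<close>

lemma cost_shift:
  "cost x (y + scaleE (of_real t) w)
     = cost x y - 2 * t * (Re (pair (A (x - y)) w) - Re (pair (B y) w)) + t\<^sup>2 * (A.q w + B.q w)"
proof -
  have eq: "x - (y + scaleE (of_real t) w) = (x - y) + scaleE (of_real (- t)) w"
    by simp
  have "A.q (x - (y + scaleE (of_real t) w))
      = A.q (x - y) + t\<^sup>2 * A.q w - 2 * t * Re (pair (A (x - y)) w)"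
    unfolding eq A.q_add A.q_scale
    unfolding pair_scale_right
    by simp
  moreover have "B.q (y + scaleE (of_real t) w) = B.q y + t\<^sup>2 * B.q w + 2 * t * Re (pair (B y) w)"
    unfolding B.q_add B.q_scale unfolding pair_scale_right by simp
  ultimately show ?thesis by (simp add: algebra_simps)
qed

text \<open>A minimising sequence is Cauchy for both seminorms by \<open>cost_diff\<close>, which
  yields \<open>\<xi>\<close> and \<open>\<eta>\<close>. Stationarity at the minimum makes their
  images under the two maps \<open>J\<close> equal.\<close>

lemma splits_exists: "\<exists>f. splits x f \<and> pair f x = of_real (min_cost x)"
proof -
  obtain y where y: "(\<lambda>n. cost x (y n)) \<longlonglongrightarrow> min_cost x"
    using minimizing_sequence by blast
  have cauchy: "\<exists>N. \<forall>m\<ge>N. \<forall>n\<ge>N. A.q (y m - y n) + B.q (y m - y n) < e" if e: "e > 0" for e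
  proof -
    obtain N where N: "\<And>n. n \<ge> N \<Longrightarrow> \<bar>cost x (y n) - min_cost x\<bar> < e / 4"
      using LIMSEQ_D[OF y, of "e / 4"] e by auto
    have "A.q (y m - y n) + B.q (y m - y n) < e" if "m \<ge> N" "n \<ge> N" for m n
      using cost_diff[of "y m" "y n" x] N[OF that(1)] N[OF that(2)] by argo
    then show ?thesis by blast
  qed
  have "\<exists>N. \<forall>m\<ge>N. \<forall>n\<ge>N. A.q ((x - y m) - (x - y n)) < e" if "e > 0" for e
  proof -
    have "A.q ((x - y m) - (x - y n)) \<le> A.q (y m - y n) + B.q (y m - y n)" for m n
      using q_minus(1)[of "y m - y n"] B.q_nonneg[of "y m - y n"] by simp
    then show ?thesis using cauchy[OF that] by (meson le_less_trans)
  qed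
  from A.approx_of_Cauchy[OF this] obtain \<xi> where \<xi>: "A.approx (\<lambda>n. x - y n) \<xi>" ..
  have "\<exists>N. \<forall>m\<ge>N. \<forall>n\<ge>N. B.q (y m - y n) < e" if "e > 0" for e
  proof -
    have "B.q (y m - y n) \<le> A.q (y m - y n) + B.q (y m - y n)" for m n
      using A.q_nonneg[of "y m - y n"] by simp
    then show ?thesis using cauchy[OF that] by (meson le_less_trans)
  qed
  from B.approx_of_Cauchy[OF this] obtain \<eta> where \<eta>: "B.approx y \<eta>" ..
  note J = A.aux_J_pair[OF complete A.approxD(1)[OF \<xi>]] B.aux_J_pair[OF complete B.approxD(1)[OF \<eta>]]
  have real_eq: "Re (pair (A.J \<xi>) w) = Re (pair (B.J \<eta>) w)" for w
  proof -
    define g where "g = Re (pair (A.J \<xi>) w) - Re (pair (B.J \<eta>) w)"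
    define T where "T = A.q w + B.q w"
    have T: "T \<ge> 0" using A.q_nonneg B.q_nonneg by (simp add: T_def)
    \<comment> \<open>Shifting the minimising sequence by a multiple of \<open>w\<close> cannot push
      the cost below the infimum, so in the limit the linear term is bounded by the quadratic
      one.\<close>
    have bound: "2 * t * g \<le> t\<^sup>2 * T" for t
    proof -
      have "(\<lambda>n. cost x (y n) - 2 * t * (Re (pair (A (x - y n)) w) - Re (pair (B (y n)) w)) + t\<^sup>2 * T)
          \<longlonglongrightarrow> min_cost x - 2 * t * g + t\<^sup>2 * T"
        unfolding g_def J
        by (intro tendsto_intros y A.approx_inner_left \<xi> B.approx_inner_left \<eta>)
      then have "min_cost x \<le> min_cost x - 2 * t * g + t\<^sup>2 * T"
        by (rule LIMSEQ_le_const)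
          (use min_cost_le[of x "y _ + scaleE (of_real t) w"] in \<open>simp add: cost_shift T_def\<close>)
      then show ?thesis by simp
    qed
    \<comment> \<open>Taking \<open>t = g / (T + 1)\<close> gives
      \<open>2 * g\<^sup>2 / (T + 1) \<le> g\<^sup>2 / (T + 1)\<close>; the summand 1 keeps the
      denominator positive when \<open>T = 0\<close>.\<close>
    have "2 * (g / (T + 1)) * g \<le> (g / (T + 1))\<^sup>2 * T" by (rule bound)
    also have "\<dots> \<le> (g / (T + 1))\<^sup>2 * (T + 1)" by (rule mult_left_mono) auto
    also have "\<dots> = g\<^sup>2 / (T + 1)" using T by (simp add: power2_eq_square)
    finally have "2 * (g\<^sup>2 / (T + 1)) \<le> g\<^sup>2 / (T + 1)" by (simp add: power2_eq_square)
    then have "g\<^sup>2 / (T + 1) \<le> 0" by simp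
    then have "g = 0" using T by (simp add: divide_le_0_iff)
    then show ?thesis by (simp add: g_def)
  qed
  \<comment> \<open>Replacing \<open>w\<close> by \<open>scaleE \<i> w\<close> in the real equation
    gives the imaginary parts.\<close>
  have "pair (A.J \<xi>) w = pair (B.J \<eta>) w" for w
    using real_eq[of w] real_eq[of "scaleE \<i> w"]
    by (simp add: pair_scale_right complex_eq_iff)
  then have J_eq: "A.J \<xi> = B.J \<eta>" by (rule pair_eqI)
  note J_pair = splits_pair[OF \<xi> \<eta> refl J_eq[symmetric]]
  \<comment> \<open>The costs tend to the infimum by the choice of \<open>y\<close>, and to
    \<open>pair (A.J \<xi>) x\<close> by \<open>splits_pair\<close>.\<close>
  have "(\<lambda>n. pair (A (x - y n)) (x - y n) + pair (B (y n)) (y n)) \<longlonglongrightarrow> pair (A.J \<xi>) x"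
    unfolding J_pair by (intro tendsto_add A.approx_inner B.approx_inner \<xi> \<eta>)
  then have "(\<lambda>n. complex_of_real (cost x (y n))) \<longlonglongrightarrow> pair (A.J \<xi>) x"
    unfolding of_real_add A.pair_self[symmetric] B.pair_self[symmetric] .
  then have "pair (A.J \<xi>) x = of_real (min_cost x)"
    using tendsto_of_real[OF y] LIMSEQ_unique by blast
  with splitsI[OF \<xi> \<eta> refl J_eq[symmetric]] show ?thesis by blast
qed

section \<open>The parallel sum as an operator\<close>

definition par :: "'e \<Rightarrow> 'f" where
  "par x = (THE f. splits x f)"

lemma par_eq: "splits x f \<Longrightarrow> par x = f"
  unfolding par_def using splits_unique by blast

lemma splits_par: "splits x (par x)"
  using splits_exists par_eq by metis

lemma pair_par: "pair (par x) x = of_real (min_cost x)"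
  using splits_exists par_eq by metis

lemma positive_par: "positive_operator scaleE scaleF pair par"
  unfolding positive_operator_def
proof (intro conjI allI)
  show "Vector_Spaces.linear scaleE scaleF par"
  proof
    show "par (x + y) = par x + par y" for x y
      by (intro par_eq splits_add splits_par)
    show "par (scaleE c x) = scaleF c (par x)" for c x
      by (intro par_eq splits_scale splits_par)
  qed
  show "pair (par x) x \<in> \<real>\<^sub>\<ge>\<^sub>0" for x
    by (simp add: pair_par min_cost_nonneg)
qed

sublocale par: positive_op scaleE scaleF pair par
  by unfold_locales (rule positive_par)

lemma q_par: "par.q x = min_cost x"
  by (simp add: pair_par)

text \<open>The trial choices \<open>y = 0\<close> and \<open>y = x\<close> charge the whole of
  \<open>x\<close> to one of the two forms.\<close>

lemma par_le: "par.q x \<le> A.q x" "par.q x \<le> B.q x"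
  using min_cost_le[of x 0] min_cost_le[of x x]
  by (simp_all add: q_par pair_zero_right)

text \<open>Two candidates have the same quadratic form, so their difference is a positive operator
  with zero form and vanishes by \<open>positive_definite\<close>.\<close>

lemma parallel_sum_eq: "parallel_sum scaleE scaleF pair A B = par"
proof -
  have eq: "(INF y. Re (pair (A (x - y)) (x - y) + pair (B y) y)) = min_cost x" for x
    by simp
  show ?thesis
    unfolding parallel_sum_def eq
  proof (rule the_equality)
    show "par \<in> weakly_continuous_operators scaleE scaleF pair \<and>
        positive_operator scaleE scaleF pair par \<and> (\<forall>x. pair (par x) x = of_real (min_cost x))"
      using par.weakly_continuous positive_par pair_par by blast
    fix C assume C: "C \<in> weakly_continuous_operators scaleE scaleF pair \<and>
        positive_operator scaleE scaleF pair C \<and> (\<forall>x. pair (C x) x = of_real (min_cost x))"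
    interpret C: positive_op scaleE scaleF pair C
      by unfold_locales (use C in blast)
    have diff0: "pair (C x - par x) x = 0" for x
      using C by (simp add: pair_diff_left pair_par)
    have "Vector_Spaces.linear scaleE scaleF (\<lambda>x. C x - par x)"
      by unfold_locales (simp_all add: C.lin.add par.lin.add C.lin.scale par.lin.scale
          F.scale_right_diff_distrib)
    then have "positive_operator scaleE scaleF pair (\<lambda>x. C x - par x)"
      by (simp add: positive_operator_def diff0)
    then have "C x - par x = 0" for x
      using positive_definite[of "\<lambda>x. C x - par x" x] diff0 by blast
    then show "C = par" by (intro ext) simp
  qed
qed
end

section \<open>Singularity\<close>

text \<open>The conjugate compensates the conjugate linearity of \<open>pair f\<close>, so that the
  operator is linear.\<close>

lemma (in anti_dual_pair) positive_rank_one: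
  assumes "0 \<le> t"
  shows "positive_operator scaleE scaleF pair (\<lambda>x. scaleF (of_real t * cnj (pair f x)) f)"
    and "pair (scaleF (of_real t * cnj (pair f x)) f) x = of_real (t * (cmod (pair f x))\<^sup>2)"
proof -
  show eq: "pair (scaleF (of_real t * cnj (pair f x)) f) x = of_real (t * (cmod (pair f x))\<^sup>2)" for x
    using complex_norm_square[of "pair f x"] by (simp add: pair_scale_left mult.commute mult.left_commute)
  have "Vector_Spaces.linear scaleE scaleF (\<lambda>x. scaleF (of_real t * cnj (pair f x)) f)"
    by unfold_locales (simp_all add: pair_add_right pair_scale_right F.scale_left_distrib algebra_simps)
  then show "positive_operator scaleE scaleF pair (\<lambda>x. scaleF (of_real t * cnj (pair f x)) f)"
    unfolding positive_operator_def eq nonneg_Reals_of_real_iff using assms by simp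
qed

text \<open>A common radius suffices: an open box around the point contains a product of balls, and
  the smaller of their radii serves both factors.\<close>

lemma closure_of_prod_metric:
  assumes "Metric_space M d" "Metric_space N e" "a \<in> M" "b \<in> N" "T \<subseteq> M \<times> N"
  shows "(a, b) \<in> prod_topology (Metric_space.mtopology M d) (Metric_space.mtopology N e) closure_of T
    \<longleftrightarrow> (\<forall>r>0. \<exists>(x, y)\<in>T. d x a < r \<and> e y b < r)"
    (is "?lhs \<longleftrightarrow> ?rhs")
proof -
  interpret M: Metric_space M d by fact
  interpret N: Metric_space N e by fact
  show ?thesis
  proof
    assume l: ?lhs
    show ?rhs
    proof (intro allI impI)
      fix r :: real assume "r > 0"
      then have "(a, b) \<in> M.mball a r \<times> N.mball b r"
        using assms by simp
      moreover have "openin (prod_topology M.mtopology N.mtopology) (M.mball a r \<times> N.mball b r)"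
        by (simp add: openin_prod_Times_iff)
      ultimately obtain x y where "(x, y) \<in> T" "x \<in> M.mball a r" "y \<in> N.mball b r"
        using l[unfolded in_closure_of, THEN conjunct2, rule_format, of "M.mball a r \<times> N.mball b r"]
        by auto
      then show "\<exists>(x, y)\<in>T. d x a < r \<and> e y b < r"
        using M.commute[of x a] N.commute[of y b] by (intro bexI[of _ "(x, y)"]) auto
    qed
  next
    assume rhs: ?rhs
    show ?lhs
      unfolding in_closure_of
    proof (intro conjI allI impI)
      show "(a, b) \<in> topspace (prod_topology M.mtopology N.mtopology)"
        using assms by simp
      fix W assume W: "(a, b) \<in> W \<and> openin (prod_topology M.mtopology N.mtopology) W"
      then have "\<exists>U V. openin M.mtopology U \<and> openin N.mtopology V \<and> a \<in> U \<and> b \<in> V \<and> U \<times> V \<subseteq> W"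
        unfolding openin_prod_topology_alt by simp
      then obtain U V where U: "openin M.mtopology U" "a \<in> U" and V: "openin N.mtopology V" "b \<in> V"
        and UV: "U \<times> V \<subseteq> W" by blast
      obtain r where r: "r > 0" "M.mball a r \<subseteq> U"
        using U unfolding M.openin_mtopology by blast
      obtain s where s: "s > 0" "N.mball b s \<subseteq> V"
        using V unfolding N.openin_mtopology by blast
      obtain x y where xy: "(x, y) \<in> T" "d x a < min r s" "e y b < min r s"
        using rhs[rule_format, of "min r s"] r(1) s(1) by auto
      then have "x \<in> M.mball a r" "y \<in> N.mball b s"
        using assms M.commute[of x a] N.commute[of y b] by auto
      then have "(x, y) \<in> W" using r s UV by blast
      with xy(1) show "\<exists>z. z \<in> T \<and> z \<in> W" by blast
    qed
  qed
qed

section \<open>Density of the joint range and approximate splittings\<close>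

context positive_op_pair
begin

lemma joint_closure_iff:
  "p \<in> joint_topology scaleF pair A B closure_of joint_range scaleF pair A B \<longleftrightarrow>
     p \<in> ip_carrier A.H \<times> ip_carrier B.H \<and>
     (\<forall>r>0. \<exists>x. ip_dist A.H (A.emb x) (fst p) < r \<and> ip_dist B.H (B.emb x) (snd p) < r)"
proof (cases "p \<in> ip_carrier A.H \<times> ip_carrier B.H")
  case True
  obtain a b where p: "p = (a, b)" "a \<in> ip_carrier A.H" "b \<in> ip_carrier B.H"
    using True by blast
  have sub: "joint_range scaleF pair A B \<subseteq> ip_carrier A.H \<times> ip_carrier B.H"
    unfolding joint_range_def using A.emb_closed B.emb_closed by blast
  have "(\<exists>(u, v)\<in>joint_range scaleF pair A B. P u v) \<longleftrightarrow> (\<exists>x. P (A.emb x) (B.emb x))" for P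
    unfolding joint_range_def Bex_def split_paired_Ex case_prod_conv mem_Collect_eq prod.inject
    by blast
  then show ?thesis
    unfolding joint_topology_def ip_topology_def p(1)
      closure_of_prod_metric[OF A.H.metric_space B.H.metric_space p(2,3) sub]
    using p(2,3) by simp
next
  case False
  have "topspace (joint_topology scaleF pair A B) = ip_carrier A.H \<times> ip_carrier B.H"
    by (simp add: joint_topology_def ip_topology_def)
  then show ?thesis using False by (simp add: in_closure_of)
qed

text \<open>The epsilon form of the sequence condition, and the hub to which all assertions of the
  theorem are reduced.\<close>

definition separated :: bool where
  "separated \<longleftrightarrow> (\<forall>x. \<forall>e>0. \<exists>y. A.q y < e \<and> B.q (x - y) < e)"

lemma separatedD:
  assumes "separated" "e > 0"
  shows "\<exists>y. sqrt (A.q y) < e \<and> sqrt (B.q (x - y)) < e"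
proof -
  have "e\<^sup>2 > 0" using assms(2) by simp
  then obtain y where "A.q y < e\<^sup>2" "B.q (x - y) < e\<^sup>2"
    using assms(1) unfolding separated_def by blast
  then have "sqrt (A.q y) < e" "sqrt (B.q (x - y)) < e"
    using assms(2) by (auto intro!: real_less_lsqrt)
  then show ?thesis by blast
qed

lemma separated_iff_sequence:
  "separated \<longleftrightarrow> (\<forall>x. \<exists>xs :: nat \<Rightarrow> 'e. (\<lambda>n. pair (A (xs n)) (xs n)) \<longlonglongrightarrow> 0 \<and>
     (\<lambda>n. pair (B (x - xs n)) (x - xs n)) \<longlonglongrightarrow> 0)"
proof
  assume s: separated
  show "\<forall>x. \<exists>xs :: nat \<Rightarrow> 'e. (\<lambda>n. pair (A (xs n)) (xs n)) \<longlonglongrightarrow> 0 \<and>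
      (\<lambda>n. pair (B (x - xs n)) (x - xs n)) \<longlonglongrightarrow> 0"
  proof
    fix x
    have "\<exists>y. \<forall>n. A.q (y n) < inverse (real (Suc n)) \<and> B.q (x - y n) < inverse (real (Suc n))"
      by (intro choice allI s[unfolded separated_def, rule_format]) simp
    then obtain y where y: "\<And>n. A.q (y n) < inverse (real (Suc n))"
      "\<And>n. B.q (x - y n) < inverse (real (Suc n))" by blast
    have "norm (pair (A (y n)) (y n)) \<le> inverse (real (Suc n))" for n
      using y(1)[of n] A.q_nonneg[of "y n"] by (subst A.pair_self) simp
    then have "(\<lambda>n. pair (A (y n)) (y n)) \<longlonglongrightarrow> 0"
      by (intro Lim_null_comparison[OF always_eventually LIMSEQ_inverse_real_of_nat] allI)
    moreover have "norm (pair (B (x - y n)) (x - y n)) \<le> inverse (real (Suc n))" for n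
      using y(2)[of n] B.q_nonneg[of "x - y n"] by (subst B.pair_self) simp
    then have "(\<lambda>n. pair (B (x - y n)) (x - y n)) \<longlonglongrightarrow> 0"
      by (intro Lim_null_comparison[OF always_eventually LIMSEQ_inverse_real_of_nat] allI)
    ultimately show "\<exists>xs :: nat \<Rightarrow> 'e. (\<lambda>n. pair (A (xs n)) (xs n)) \<longlonglongrightarrow> 0 \<and>
        (\<lambda>n. pair (B (x - xs n)) (x - xs n)) \<longlonglongrightarrow> 0" by blast
  qed
next
  assume r: "\<forall>x. \<exists>xs :: nat \<Rightarrow> 'e. (\<lambda>n. pair (A (xs n)) (xs n)) \<longlonglongrightarrow> 0 \<and>
      (\<lambda>n. pair (B (x - xs n)) (x - xs n)) \<longlonglongrightarrow> 0"
  show separated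
    unfolding separated_def
  proof (intro allI impI)
    fix x and e :: real assume e: "e > 0"
    obtain y :: "nat \<Rightarrow> 'e" where y: "(\<lambda>n. pair (A (y n)) (y n)) \<longlonglongrightarrow> 0"
      "(\<lambda>n. pair (B (x - y n)) (x - y n)) \<longlonglongrightarrow> 0" using r by blast
    have "eventually (\<lambda>n. A.q (y n) < e \<and> B.q (x - y n) < e) sequentially"
      using tendsto_Re[OF y(1)] tendsto_Re[OF y(2)] e
      by (intro eventually_conj order_tendstoD(2)) auto
    from eventually_happens'[OF sequentially_bot this]
    obtain n where "A.q (y n) < e \<and> B.q (x - y n) < e" ..
    then show "\<exists>y. A.q y < e \<and> B.q (x - y) < e" by (rule exI[of _ "y n"])
  qed
qed

text \<open>Both sides say that the infimum \<open>min_cost x\<close> is 0 for every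
  \<open>x\<close>; an operator with vanishing form vanishes by
  \<open>positive_definite\<close>.\<close>

lemma par_zero_iff_separated: "par = (\<lambda>x. 0) \<longleftrightarrow> separated"
proof
  assume "par = (\<lambda>x. 0)"
  then have z: "min_cost x = 0" for x
    using q_par[of x] by (simp add: pair_zero)
  show separated
    unfolding separated_def
  proof (intro allI impI)
    fix x and e :: real assume "e > 0"
    then obtain y where "cost x y < e" using near_min_cost[of e x] unfolding z by auto
    \<comment> \<open>The roles are exchanged: \<open>cost x y\<close> charges \<open>x - y\<close>
      to \<open>A\<close>, whereas \<open>separated\<close> charges its witness to \<open>A\<close>,
      so the witness is \<open>x - y\<close>.\<close>
    then have "A.q (x - y) < e" "B.q (x - (x - y)) < e"
      using A.q_nonneg[of "x - y"] B.q_nonneg[of y] by simp_all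
    then show "\<exists>y. A.q y < e \<and> B.q (x - y) < e" by blast
  qed
next
  assume s: separated
  show "par = (\<lambda>x. 0)"
  proof
    fix x
    have "min_cost x \<le> e" if e: "e > 0" for e
    proof -
      obtain y where "A.q y < e / 2" "B.q (x - y) < e / 2"
        using s[unfolded separated_def, rule_format, OF half_gt_zero[OF e]] by blast
      then show ?thesis using min_cost_le[of x "x - y"] by simp
    qed
    then have "min_cost x \<le> 0" by (rule field_le_epsilon[of _ 0, simplified])
    then have "pair (par x) x = 0" using min_cost_nonneg[of x] by (simp add: pair_par)
    then show "par x = 0" by (rule positive_definite[OF positive_par])
  qed
qed

text \<open>The parallel sum is itself a positive common lower bound of \<open>A\<close> and
  \<open>B\<close>.\<close>

lemma mutually_singular_imp_par_zero:
  assumes "mutually_singular scaleE scaleF pair A B"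
  shows "par = (\<lambda>x. 0)"
proof -
  have diff: "positive_operator scaleE scaleF pair (\<lambda>x. C x - par x)"
    if "positive_operator scaleE scaleF pair C" and le: "\<And>x. par.q x \<le> Re (pair (C x) x)" for C
  proof -
    interpret C: positive_op scaleE scaleF pair C
      by unfold_locales fact
    have "Vector_Spaces.linear scaleE scaleF (\<lambda>x. C x - par x)"
      by unfold_locales (simp_all add: C.lin.add par.lin.add C.lin.scale par.lin.scale
          F.scale_right_diff_distrib)
    moreover have "pair (C x - par x) x = of_real (C.q x - par.q x)" for x
      using C.pair_self[of x] par.pair_self[of x] by (simp add: pair_diff_left)
    ultimately show ?thesis using le by (simp add: positive_operator_def del: of_real_diff)
  qed
  show ?thesis
    using assms par.weakly_continuous positive_par
      diff[OF positive_A par_le(1)] diff[OF positive_B par_le(2)]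
    unfolding mutually_singular_def operator_le_def by blast
qed

text \<open>The seminorm of a common lower bound \<open>C\<close> is dominated by both seminorms;
  splitting \<open>x\<close> as \<open>y + (x - y)\<close> and using the \<open>A\<close> bound on
  one part and the \<open>B\<close> bound on the other makes it arbitrarily small.\<close>

lemma separated_imp_mutually_singular:
  assumes separated
  shows "mutually_singular scaleE scaleF pair A B"
  unfolding mutually_singular_def
proof (intro ballI impI)
  fix C assume C: "positive_operator scaleE scaleF pair C \<and>
    operator_le scaleE scaleF pair C A \<and> operator_le scaleE scaleF pair C B"
  interpret C: positive_op scaleE scaleF pair C
    by unfold_locales (use C in blast)
  have le: "C.q x \<le> A.q x" "C.q x \<le> B.q x" for x
    using C unfolding operator_le_def positive_operator_def pair_diff_left
    by (auto simp: complex_nonneg_Reals_iff)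
  show "C = (\<lambda>x. 0)"
  proof
    fix x
    have "sqrt (C.q x) \<le> e" if e: "e > 0" for e
    proof -
      obtain y where y: "sqrt (A.q y) < e / 2" "sqrt (B.q (x - y)) < e / 2"
        using separatedD[OF assms half_gt_zero[OF e]] by blast
      have "sqrt (C.q x) \<le> sqrt (C.q y) + sqrt (C.q (x - y))"
        using C.q_triangle[of y "x - y"] by simp
      also have "\<dots> \<le> sqrt (A.q y) + sqrt (B.q (x - y))"
        by (intro add_mono real_sqrt_le_mono le)
      finally show ?thesis using y by simp
    qed
    then have "sqrt (C.q x) \<le> 0" by (rule field_le_epsilon[of _ 0, simplified])
    then have "C.q x = 0" using C.q_nonneg[of x] by simp
    then have "pair (C x) x = 0" using C.pair_self[of x] by simp
    then show "C x = 0" by (rule positive_definite[OF C.positive])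
  qed
qed

text \<open>The two components are first approximated by unrelated vectors \<open>u n\<close> and
  \<open>v n\<close>; a splitting of their difference merges these into one vector.\<close>

lemma separated_imp_dense:
  assumes separated
  shows "joint_topology scaleF pair A B closure_of joint_range scaleF pair A B
    = ip_carrier A.H \<times> ip_carrier B.H"
proof (intro equalityI subsetI)
  fix p assume "p \<in> ip_carrier A.H \<times> ip_carrier B.H"
  then obtain \<xi> \<eta> where p: "p = (\<xi>, \<eta>)" "\<xi> \<in> ip_carrier A.H" "\<eta> \<in> ip_carrier B.H" by blast
  obtain u where u: "A.approx u \<xi>" using p(2) by (rule A.approx_exists)
  obtain v where v: "B.approx v \<eta>" using p(3) by (rule B.approx_exists)
  have "\<exists>x. ip_dist A.H (A.emb x) \<xi> < r \<and> ip_dist B.H (B.emb x) \<eta> < r" if r: "r > 0" for r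
  proof -
    have "eventually (\<lambda>n. ip_dist A.H (A.emb (u n)) \<xi> < r / 2 \<and> ip_dist B.H (B.emb (v n)) \<eta> < r / 2) sequentially"
      using A.approxD(2)[OF u] B.approxD(2)[OF v] r
      by (intro eventually_conj order_tendstoD(2)) auto
    from eventually_happens'[OF sequentially_bot this]
    obtain n where n: "ip_dist A.H (A.emb (u n)) \<xi> < r / 2" "ip_dist B.H (B.emb (v n)) \<eta> < r / 2"
      by blast
    \<comment> \<open>Then \<open>u n + y\<close> is close to \<open>u n\<close> for
      \<open>A\<close>, and to \<open>v n\<close> for \<open>B\<close> because
      \<open>v n - u n - y\<close> is small there.\<close>
    obtain y where y: "sqrt (A.q y) < r / 2" "sqrt (B.q (v n - u n - y)) < r / 2"
      using separatedD[OF assms half_gt_zero[OF r]] by blast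
    have "ip_dist A.H (A.emb (u n + y)) (A.emb (u n)) < r / 2"
      using y(1) by (simp add: A.dist_emb)
    moreover have "ip_dist B.H (B.emb (v n)) (B.emb (u n + y)) < r / 2"
      using y(2) by (simp add: B.dist_emb diff_diff_eq)
    ultimately show ?thesis
      using n A.H.M.triangle[OF A.emb_closed A.emb_closed p(2), of "u n + y" "u n"]
        B.H.M.triangle[OF B.emb_closed B.emb_closed p(3), of "u n + y" "v n"]
        B.H.M.commute[of "B.emb (v n)" "B.emb (u n + y)"]
      by (intro exI[of _ "u n + y"]) linarith
  qed
  then show "p \<in> joint_topology scaleF pair A B closure_of joint_range scaleF pair A B"
    unfolding joint_closure_iff using p by simp
qed (simp add: joint_closure_iff)

lemma dense_imp_multivalued_part:
  assumes "joint_topology scaleF pair A B closure_of joint_range scaleF pair A B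
    = ip_carrier A.H \<times> ip_carrier B.H"
  shows "multivalued_part scaleF pair A B = ip_carrier B.H"
  unfolding multivalued_part_def assms using A.H.zero_closed by blast

text \<open>Testing with \<open>B.emb x\<close> yields \<open>y\<close> with \<open>A y\<close> near
  0 and \<open>B y\<close> near \<open>B x\<close>, which is exactly a splitting of
  \<open>x\<close>.\<close>

lemma multivalued_part_imp_separated:
  assumes "multivalued_part scaleF pair A B = ip_carrier B.H"
  shows separated
  unfolding separated_def
proof (intro allI impI)
  fix x and e :: real assume e: "e > 0"
  have "B.emb x \<in> multivalued_part scaleF pair A B"
    unfolding assms by (rule B.emb_closed)
  then have "(A.emb 0, B.emb x) \<in> joint_topology scaleF pair A B closure_of joint_range scaleF pair A B"
    unfolding multivalued_part_def A.emb_zero by blast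
  then obtain y where y: "ip_dist A.H (A.emb y) (A.emb 0) < sqrt e" "ip_dist B.H (B.emb y) (B.emb x) < sqrt e"
    unfolding joint_closure_iff using e by (metis fst_conv snd_conv real_sqrt_gt_zero)
  have "B.q (x - y) = B.q (y - x)" using q_minus(2)[of "y - x"] by simp
  then have "A.q y < e \<and> B.q (x - y) < e"
    using y unfolding A.dist_emb B.dist_emb by simp
  then show "\<exists>y. A.q y < e \<and> B.q (x - y) < e" by blast
qed

section \<open>Vectors whose functional is bounded by the other seminorm\<close>

abbreviation "dominated_vectors \<equiv> {\<xi> \<in> ip_carrier B.H. \<exists>M\<ge>0. \<forall>x.
  (cmod (ip_inner B.H (B.emb x) \<xi>))\<^sup>2 \<le> M * A.q x}"

lemma inner_zero_left: "\<eta> \<in> ip_carrier B.H \<Longrightarrow> ip_inner B.H \<eta> (ip_zero B.H) = 0"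
  using B.H.inner_add_right[OF B.H.zero_closed B.H.zero_closed] B.H.add_zero[OF B.H.zero_closed]
  by fastforce

text \<open>The functional given by \<open>\<xi>\<close> is bounded by the seminorm of
  \<open>A\<close> by assumption and by that of \<open>B\<close> by Cauchy-Schwarz. Splitting the
  argument shows that it vanishes, so \<open>\<xi>\<close> is orthogonal to a dense set.\<close>

lemma separated_imp_dominated:
  assumes separated
  shows "dominated_vectors = {ip_zero B.H}"
proof (intro equalityI subsetI)
  fix \<xi> assume "\<xi> \<in> dominated_vectors"
  then obtain M where \<xi>: "\<xi> \<in> ip_carrier B.H" and M: "M \<ge> 0"
    "\<And>x. (cmod (ip_inner B.H (B.emb x) \<xi>))\<^sup>2 \<le> M * A.q x" by blast
  have bound: "cmod (ip_inner B.H (B.emb x) \<xi>) \<le> sqrt M * sqrt (A.q x)" for x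
    using M(2)[of x] by (metis real_le_rsqrt real_sqrt_mult)
  have "cmod (ip_inner B.H (B.emb x) \<xi>) \<le> e" if e: "e > 0" for x e
  proof -
    \<comment> \<open>The scale \<open>?k\<close> is the sum of the two bounding constants; the
      extra 1 keeps it positive when both are zero.\<close>
    let ?k = "sqrt M + ip_norm B.H \<xi> + 1"
    have k: "?k > 0" using M(1) B.H.norm_nonneg[OF \<xi>] by (simp add: add_nonneg_pos)
    obtain y where y: "sqrt (A.q y) < e / ?k" "sqrt (B.q (x - y)) < e / ?k"
      using separatedD[OF assms divide_pos_pos[OF e k]] by blast
    have "ip_inner B.H (B.emb x) \<xi> = ip_inner B.H (B.emb y) \<xi> + ip_inner B.H (B.emb (x - y)) \<xi>"
      using B.H.inner_add_left[OF B.emb_closed B.emb_closed \<xi>, of y "x - y"]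
      unfolding B.emb_add[symmetric] by simp
    then have "cmod (ip_inner B.H (B.emb x) \<xi>)
        \<le> cmod (ip_inner B.H (B.emb y) \<xi>) + cmod (ip_inner B.H (B.emb (x - y)) \<xi>)"
      by (simp add: norm_triangle_ineq)
    also have "\<dots> \<le> sqrt M * sqrt (A.q y) + sqrt (B.q (x - y)) * ip_norm B.H \<xi>"
      using bound[of y] B.H.Cauchy_Schwarz[OF B.emb_closed \<xi>, of "x - y"]
      by (simp add: B.norm_emb)
    also have "\<dots> \<le> sqrt M * (e / ?k) + (e / ?k) * ip_norm B.H \<xi>"
      using y M(1) B.H.norm_nonneg[OF \<xi>]
      by (intro add_mono mult_left_mono mult_right_mono) auto
    also have "\<dots> = (sqrt M + ip_norm B.H \<xi>) * (e / ?k)"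
      by (simp only: distrib_right mult.commute[of "ip_norm B.H \<xi>"])
    also have "\<dots> \<le> ?k * (e / ?k)"
      using k e by (intro mult_right_mono) auto
    also have "\<dots> = e" using k by simp
    finally show ?thesis .
  qed
  then have "cmod (ip_inner B.H (B.emb x) \<xi>) \<le> 0" for x
    by (rule field_le_epsilon[of _ 0, simplified])
  then have "ip_inner B.H (B.emb x) \<xi> = 0" for x by simp
  then have "ip_inner B.H \<xi> (B.emb x) = ip_inner B.H (ip_zero B.H) (B.emb x)" for x
    using B.H.inner_commute[OF B.emb_closed \<xi>, of x]
      B.H.inner_commute[OF B.emb_closed B.H.zero_closed, of x] inner_zero_left[OF B.emb_closed, of x]
    by simp
  then show "\<xi> \<in> {ip_zero B.H}"
    using B.eq_by_emb[OF \<xi> B.H.zero_closed] by blast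
next
  fix \<xi> assume "\<xi> \<in> {ip_zero B.H}"
  then show "\<xi> \<in> dominated_vectors"
    using B.H.zero_closed inner_zero_left[OF B.emb_closed] by (auto intro!: exI[of _ 0])
qed

text \<open>The vector \<open>\<eta>\<close> with \<open>B.J \<eta> = par x\<close> is dominated
  with constant \<open>par.q x\<close>: this is Cauchy-Schwarz for the form of \<open>par\<close>
  combined with \<open>par_le\<close>. Hence \<open>\<eta>\<close>, and with it
  \<open>par x\<close>, is zero.\<close>

lemma dominated_imp_par_zero:
  assumes "dominated_vectors = {ip_zero B.H}"
  shows "par = (\<lambda>x. 0)"
proof
  fix x
  obtain y \<xi> \<eta> where y: "A.approx (\<lambda>n. x - y n) \<xi>" "B.approx y \<eta>" "A.J \<xi> = par x" "B.J \<eta> = par x"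
    using splits_par[of x] unfolding splits_def by blast
  note \<eta> = B.approxD(1)[OF y(2)]
  have "(cmod (ip_inner B.H (B.emb z) \<eta>))\<^sup>2 \<le> par.q x * A.q z" for z
  proof -
    have "cmod (ip_inner B.H (B.emb z) \<eta>) = cmod (pair (par x) z)"
      using B.aux_J_pair[OF complete \<eta>, of z] B.H.inner_commute[OF \<eta> B.emb_closed, of z]
      unfolding y(4) by simp
    then have "(cmod (ip_inner B.H (B.emb z) \<eta>))\<^sup>2 \<le> par.q x * par.q z"
      using par.Cauchy_Schwarz_pair[of x z] by simp
    also have "\<dots> \<le> par.q x * A.q z"
      by (intro mult_left_mono par_le par.q_nonneg)
    finally show ?thesis .
  qed
  then have "\<eta> \<in> dominated_vectors"
    using \<eta> par.q_nonneg[of x] by blast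
  then have "\<eta> = B.emb 0" using assms unfolding B.emb_zero by blast
  then have "ip_inner B.H \<eta> (B.emb z) = pair (B 0) z" for z
    by (simp only: B.inner_emb)
  then have "pair (par x) z = pair 0 z" for z
    using B.aux_J_pair[OF complete \<eta>, of z] unfolding y(4) B.lin.zero by simp
  then show "par x = 0" by (rule pair_eqI)
qed

section \<open>The ranges of the two maps \<open>J\<close>\<close>

lemma zero_in_range_J: "0 \<in> A.J ` ip_carrier A.H" "0 \<in> B.J ` ip_carrier B.H"
proof -
  have "A.J (A.emb 0) = 0"
    by (rule pair_eqI, unfold A.aux_J_pair[OF complete A.emb_closed] A.inner_emb)
      (simp only: A.lin.zero)
  then show "0 \<in> A.J ` ip_carrier A.H" by (metis A.emb_closed imageI)
  have "B.J (B.emb 0) = 0"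
    by (rule pair_eqI, unfold B.aux_J_pair[OF complete B.emb_closed] B.inner_emb)
      (simp only: B.lin.zero)
  then show "0 \<in> B.J ` ip_carrier B.H" by (metis B.emb_closed imageI)
qed

text \<open>By construction through \<open>splits\<close>, every \<open>par x\<close> is a value of
  both maps \<open>J\<close>.\<close>

lemma ranges_J_imp_par_zero:
  assumes "A.J ` ip_carrier A.H \<inter> B.J ` ip_carrier B.H = {0}"
  shows "par = (\<lambda>x. 0)"
proof
  fix x
  obtain y \<xi> \<eta> where y: "A.approx (\<lambda>n. x - y n) \<xi>" "B.approx y \<eta>" "A.J \<xi> = par x" "B.J \<eta> = par x"
    using splits_par[of x] unfolding splits_def by blast
  have "par x \<in> A.J ` ip_carrier A.H" "par x \<in> B.J ` ip_carrier B.H"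
    using A.approxD(1)[OF y(1)] B.approxD(1)[OF y(2)] y(3,4) by (metis imageI)+
  then show "par x = 0" using assms by blast
qed

text \<open>For \<open>f = A.J \<xi>\<close>, Cauchy-Schwarz bounds \<open>pair f x\<close> by the
  norm of \<open>\<xi>\<close> times the seminorm of \<open>x\<close>, and likewise for
  \<open>B\<close>. A small multiple of the rank one operator of \<open>f\<close> is therefore a
  common lower bound, and it vanishes only for \<open>f = 0\<close>.\<close>

lemma mutually_singular_imp_ranges_J:
  assumes "mutually_singular scaleE scaleF pair A B"
  shows "A.J ` ip_carrier A.H \<inter> B.J ` ip_carrier B.H = {0}"
proof (intro equalityI subsetI)
  fix f assume "f \<in> A.J ` ip_carrier A.H \<inter> B.J ` ip_carrier B.H"
  then obtain \<xi> \<eta> where f: "f = A.J \<xi>" "\<xi> \<in> ip_carrier A.H" "f = B.J \<eta>" "\<eta> \<in> ip_carrier B.H" by blast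
  \<comment> \<open>This one factor brings both \<open>t * (ip_norm A.H \<xi>)\<^sup>2\<close> and
    \<open>t * (ip_norm B.H \<eta>)\<^sup>2\<close> below 1; the summand 1 excludes division by
    zero.\<close>
  define t where "t = 1 / ((ip_norm A.H \<xi>)\<^sup>2 + (ip_norm B.H \<eta>)\<^sup>2 + 1)"
  have s: "(ip_norm A.H \<xi>)\<^sup>2 + (ip_norm B.H \<eta>)\<^sup>2 + 1 > 0" by (simp add: add_nonneg_pos)
  have t: "t > 0" "t * (ip_norm A.H \<xi>)\<^sup>2 \<le> 1" "t * (ip_norm B.H \<eta>)\<^sup>2 \<le> 1"
    unfolding t_def using s by simp_all
  define C where "C = (\<lambda>x. scaleF (of_real t * cnj (pair f x)) f)"
  have pair_C: "pair (C x) x = of_real (t * (cmod (pair f x))\<^sup>2)" for x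
    unfolding C_def by (rule positive_rank_one(2)[OF less_imp_le[OF t(1)]])
  interpret C: positive_op scaleE scaleF pair C
    unfolding C_def by unfold_locales (rule positive_rank_one(1)[OF less_imp_le[OF t(1)]])
  have A: "(cmod (pair f x))\<^sup>2 \<le> (ip_norm A.H \<xi>)\<^sup>2 * A.q x" for x
  proof -
    have "cmod (pair f x) \<le> ip_norm A.H \<xi> * sqrt (A.q x)"
      using A.H.Cauchy_Schwarz[OF f(2) A.emb_closed, of x]
      unfolding f(1) A.aux_J_pair[OF complete f(2)] A.norm_emb .
    then have "(cmod (pair f x))\<^sup>2 \<le> (ip_norm A.H \<xi> * sqrt (A.q x))\<^sup>2"
      by (intro power_mono) auto
    then show ?thesis by (simp add: power_mult_distrib A.q_nonneg)
  qed
  have B: "(cmod (pair f x))\<^sup>2 \<le> (ip_norm B.H \<eta>)\<^sup>2 * B.q x" for x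
  proof -
    have "cmod (pair f x) \<le> ip_norm B.H \<eta> * sqrt (B.q x)"
      using B.H.Cauchy_Schwarz[OF f(4) B.emb_closed, of x]
      unfolding f(3) B.aux_J_pair[OF complete f(4)] B.norm_emb .
    then have "(cmod (pair f x))\<^sup>2 \<le> (ip_norm B.H \<eta> * sqrt (B.q x))\<^sup>2"
      by (intro power_mono) auto
    then show ?thesis by (simp add: power_mult_distrib B.q_nonneg)
  qed
  have le: "operator_le scaleE scaleF pair C D"
    if "positive_operator scaleE scaleF pair D" and n: "t * n \<le> 1"
      and D: "\<And>x. (cmod (pair f x))\<^sup>2 \<le> n * Re (pair (D x) x)" for D n
  proof -
    interpret D: positive_op scaleE scaleF pair D by unfold_locales fact
    have "t * (cmod (pair f x))\<^sup>2 \<le> D.q x" for x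
    proof -
      have "t * (cmod (pair f x))\<^sup>2 \<le> t * (n * D.q x)" by (intro mult_left_mono D less_imp_le t(1))
      also have "\<dots> = (t * n) * D.q x" by simp
      also have "\<dots> \<le> 1 * D.q x" by (intro mult_right_mono n D.q_nonneg)
      finally show ?thesis by simp
    qed
    moreover have "pair (D x - C x) x = of_real (D.q x - t * (cmod (pair f x))\<^sup>2)" for x
      unfolding pair_diff_left pair_C of_real_diff by (subst D.pair_self) simp
    moreover have "Vector_Spaces.linear scaleE scaleF (\<lambda>x. D x - C x)"
      by unfold_locales (simp_all add: C.lin.add D.lin.add C.lin.scale D.lin.scale
          F.scale_right_diff_distrib)
    ultimately show ?thesis
      by (simp add: operator_le_def positive_operator_def del: of_real_diff)
  qed
  have "C = (\<lambda>x. 0)"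
    using assms C.weakly_continuous C.positive le[OF positive_A t(2) A] le[OF positive_B t(3) B]
    unfolding mutually_singular_def by blast
  then have "pair f x = pair 0 x" for x
    using pair_C[of x] t(1) by (simp add: pair_zero)
  then have "f = 0" by (rule pair_eqI)
  then show "f \<in> {0}" by simp
qed (use zero_in_range_J in blast)

end

theorem theorem6p1:
  fixes scaleE :: "complex \<Rightarrow> 'e::ab_group_add \<Rightarrow> 'e"
    and scaleF :: "complex \<Rightarrow> 'f::ab_group_add \<Rightarrow> 'f"
    and pair :: "'f \<Rightarrow> 'e \<Rightarrow> complex"
    and A B :: "'e \<Rightarrow> 'f"
  assumes "anti_dual_pair scaleE scaleF pair"
    and "weak_star_sequentially_complete pair"
    and "A \<in> weakly_continuous_operators scaleE scaleF pair"
    and "positive_operator scaleE scaleF pair A"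
    and "B \<in> weakly_continuous_operators scaleE scaleF pair"
    and "positive_operator scaleE scaleF pair B"
  shows
    "let HA = aux_space scaleF pair A;
         HB = aux_space scaleF pair B;
         s1 = mutually_singular scaleE scaleF pair A B;
         s2 = (parallel_sum scaleE scaleF pair A B = (\<lambda>x. 0));
         s3 = (joint_topology scaleF pair A B closure_of joint_range scaleF pair A B
                 = ip_carrier HA \<times> ip_carrier HB);
         s4 = ({\<xi> \<in> ip_carrier HB. \<exists>M\<ge>0. \<forall>x.
                  (cmod (ip_inner HB (aux_embed scaleF pair B (B x)) \<xi>))\<^sup>2
                    \<le> M * Re (pair (A x) x)} = {ip_zero HB});
         s5 = (multivalued_part scaleF pair A B = ip_carrier HB);
         s6 = (aux_J scaleF pair A ` ip_carrier HA \<inter> aux_J scaleF pair B ` ip_carrier HB = {0});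
         s7 = (\<forall>x. \<exists>xs :: nat \<Rightarrow> 'e.
                 (\<lambda>n. pair (A (xs n)) (xs n)) \<longlonglongrightarrow> 0 \<and>
                 (\<lambda>n. pair (B (x - xs n)) (x - xs n)) \<longlonglongrightarrow> 0)
     in (s1 \<longleftrightarrow> s2) \<and> (s1 \<longleftrightarrow> s3) \<and> (s1 \<longleftrightarrow> s4) \<and> (s1 \<longleftrightarrow> s5) \<and> (s1 \<longleftrightarrow> s6) \<and> (s1 \<longleftrightarrow> s7)"
proof -
  interpret positive_op_pair scaleE scaleF pair A B
    using assms(1) by (rule positive_op_pair.intro)
      (rule positive_op_pair_axioms.intro[OF assms(2,4,6)])
  \<comment> \<open>Each assertion is compared with \<open>separated\<close> rather than with its
    neighbour; rewriting then leaves only trivial equivalences.\<close>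
  have s1: "mutually_singular scaleE scaleF pair A B \<longleftrightarrow> separated"
    using mutually_singular_imp_par_zero par_zero_iff_separated separated_imp_mutually_singular
    by (intro iffI) simp_all
  have s3: "joint_topology scaleF pair A B closure_of joint_range scaleF pair A B
      = ip_carrier A.H \<times> ip_carrier B.H \<longleftrightarrow> separated"
    by (rule iffI[OF multivalued_part_imp_separated[OF dense_imp_multivalued_part]
          separated_imp_dense])
  have s4: "dominated_vectors = {ip_zero B.H} \<longleftrightarrow> separated"
    by (rule iffI[OF dominated_imp_par_zero[THEN iffD1[OF par_zero_iff_separated]]
          separated_imp_dominated])
  have s5: "multivalued_part scaleF pair A B = ip_carrier B.H \<longleftrightarrow> separated"
    by (rule iffI[OF multivalued_part_imp_separated
          dense_imp_multivalued_part[OF separated_imp_dense]])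
  have s6: "A.J ` ip_carrier A.H \<inter> B.J ` ip_carrier B.H = {0} \<longleftrightarrow> separated"
    by (rule iffI[OF ranges_J_imp_par_zero[THEN iffD1[OF par_zero_iff_separated]]
          mutually_singular_imp_ranges_J[OF separated_imp_mutually_singular]])
  show ?thesis
    unfolding Let_def parallel_sum_eq par_zero_iff_separated separated_iff_sequence[symmetric]
      s1 s3 s4 s5 s6
    by (intro conjI refl)
qed

end
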